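(* Let $(F,W,P,\boldsymbol{q})$ be a many-to-one matching market (with strict preferences, and $\boldsymbol{q}$-responsive preferences for firms). Then $$SSF(P)=\bigcup_{\mu\in S(P)}\mathrm{Conv}\{\mathcal M_\mu\},$$ where $SSF(P)$ is the set of all strongly stable fractional matchings, $S(P)$ is the set of all stable matchings, $\mathcal M_\mu=\{\mu[K]:K\subseteq\Phi(\mu)\}$, and $\mathrm{Conv}\{\mathcal M_\mu\}$ is the convex hull of the incidence vectors of the matchings in $\mathcal M_\mu$.
   Context: MARKET. $F$ (firms) and $W$ (workers) are finite disjoint sets. Each worker $w$ has a strict linear order $\succ_w$ on $F\cup\{w\}$ ($w$ stands for being unmatched). Each firm $f$ has a quota $q_f$ (a positive integer) and a strict linear order $\succ_f$ on $2^W$; $\boldsymbol q=(q_f)_{f\in F}$; $P$ is the profile of all these preferences. $\succeq$ denotes "$\succ$ or equal". For workers $j,w$ write $j\succ_f w$ for $\{j\}\succ_f\{w\}$. Firms' preferences are $\boldsymbol q$-responsive: (1) $\emptyset\succ_f T$ whenever $|T|>q_f$; (2) if $|T|<q_f$ and $w\notin T$, then $T\cup\{w\}\succ_f T$ iff $\{w\}\succ_f\emptyset$; (3) if $|T|<q_f$ and $w,w'\notin T$, then $T\cup\{w\}\succ_f T\cup\{w'\}$ iff $w\succ_f w'$. A pair $(f,w)$ is acceptable if $\{w\}\succ_f\emptyset$ and $f\succ_w w$; $A=A(P)$ is the set of acceptable pairs. MATCHINGS. A matching $\mu$ assigns to each worker $w$ either one firm or $w$ itself (unmatched), and to each firm $f$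 a set $\mu(f)\subseteq W$ with $|\mu(f)|\le q_f$, so that $\mu(w)=f$ iff $w\in\mu(f)$. $\mu$ is individually rational if every matched pair is acceptable. A pair $(f,w)$ with $\mu(w)\ne f$ blocks $\mu$ if $f\succ_w\mu(w)$ and either $|\mu(f)|=q_f$ and $w\succ_f w'$ for some $w'\in\mu(f)$, or $|\mu(f)|<q_f$ and $\{w\}\succ_f\emptyset$. $\mu$ is stable if it is individually rational and has no blocking pair. The incidence vector $x^\mu\in\{0,1\}^{F\times W}$ has $x^\mu_{f,w}=1$ iff $\mu(w)=f$. $\mu_W$ denotes the worker-optimal stable matching (every worker weakly prefers it to every other stable matching). STRONG STABILITY. The polytope $CP$ is the set of $x\in\mathbb{R}^{F\times W}$ with $\sum_{j\in W}x_{f,j}\le q_f$ for all $f$; $\sum_{i\in F}x_{i,w}\le 1$ for all $w$; $x_{f,w}\ge0$ for all $(f,w)$; $x_{f,w}=0$ for $(f,w)\notin A$. A strongly stable fractional matching is a (not necessarily integer) point $\bar x\in CP$ such that for every $(f,w)\in A$, $$\Bigl[q_f-\sum_{j\succeq_f w}\bar x_{f,j}\Bigr]\cdot\Bigl[1-\sum_{i\succeq_w f}\bar x_{i,w}\Bigr]=0.$$ Sums over $j$ range over workers, sums over $i$ over firms. REDUCED PROFILE $P^\mu$ of a stable matching $\mu$. Start with each firm's list of acceptable individual workers and each worker's list of acceptable firms, ordered by preference. Step 1: for each $f$ with $\mu(f)\neq\emptyset$ remove from $f$'s list all workers preferred by $f$ to its most preferred worker in $\mu(f)$; for each $w$ remove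 from $w$'s list all firms preferred by $w$ to $\mu_W(w)$. Step 2: for each $w$ remove from $w$'s list all firms less preferred than $\mu(w)$; for each $f$ with $\mu_W(f)\ne\emptyset$ remove from $f$'s list all workers less preferred than its least preferred worker in $\mu_W(f)$. Step 3: after Steps 1 and 2, if $f$ is not on $w$'s list remove $w$ from $f$'s list, and if $w$ is not on $f$'s list remove $f$ from $w$'s list. The resulting lists form $P^\mu$. CYCLES. A set of firms $\sigma=\{e_1,\dots,e_r\}$ (indices mod $r$, $e_{r+1}=e_1$) is a cycle of $P^\mu$ if there are workers $w_{e_1},\dots,w_{e_r}$ such that for each $d$: $w_{e_d}$ is the most preferred worker for $e_d$ among the workers on $e_d$'s list in $P^\mu$ that are not in $\mu(e_d)$, and $w_{e_d}\in\mu(e_{d+1})$. The cyclic matching $\mu[\sigma]$ is given by $\mu[\sigma](e_d)=(\mu(e_d)\setminus\{w_{e_{d-1}}\})\cup\{w_{e_d}\}$ for $d=1,\dots,r$ (with $e_0=e_r$) and $\mu[\sigma](f)=\mu(f)$ for $f\notin\sigma$. $\Phi(\mu)$ is the set of cycles of $P^\mu$; distinct cycles in $\Phi(\mu)$ are disjoint. For $K\subseteq\Phi(\mu)$, $\mu[K]$ is the matching with $\mu[K](f)=\mu[\sigma](f)$ if $f\in\sigma\in K$ and $\mu[K](f)=\mu(f)$ if $f$ lies in no cycle of $K$ (so $\mu[\emptyset]=\mu$). *)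

theory Defs
  imports "HOL-Analysis.Analysis"
begin

text \<open>
  Firms are the elements of the finite type \<open>'f\<close>, workers those of the finite type \<open>'w\<close>.
  For a worker, \<open>Some f\<close> is being matched to \<open>f\<close> and \<open>None\<close> is being unmatched.
  Preference relations are strict: \<open>prefF f T U\<close> says that \<open>f\<close> prefers \<open>T\<close> to \<open>U\<close>.
\<close>

locale market =
  fixes q :: "'f::finite \<Rightarrow> nat"
    and prefF :: "'f \<Rightarrow> 'w::finite set \<Rightarrow> 'w set \<Rightarrow> bool"
    and prefW :: "'w \<Rightarrow> 'f option \<Rightarrow> 'f option \<Rightarrow> bool"
  assumes quota_pos: "0 < q f"
    and prefF_linear: "irreflp (prefF f)" "transp (prefF f)" "totalp (prefF f)"
    and prefW_linear: "irreflp (prefW w)" "transp (prefW w)" "totalp (prefW w)"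
    and responsive_quota: "q f < card T \<Longrightarrow> prefF f {} T"
    and responsive_add:
      "card T < q f \<Longrightarrow> w \<notin> T \<Longrightarrow> prefF f (T \<union> {w}) T \<longleftrightarrow> prefF f {w} {}"
    and responsive_swap:
      "card T < q f \<Longrightarrow> w \<notin> T \<Longrightarrow> w' \<notin> T \<Longrightarrow>
        prefF f (T \<union> {w}) (T \<union> {w'}) \<longleftrightarrow> prefF f {w} {w'}"
begin

definition weakF :: "'f \<Rightarrow> 'w \<Rightarrow> 'w \<Rightarrow> bool" where
  "weakF f j w \<longleftrightarrow> prefF f {j} {w} \<or> j = w"

definition weakW :: "'w \<Rightarrow> 'f option \<Rightarrow> 'f option \<Rightarrow> bool" where
  "weakW w a b \<longleftrightarrow> prefW w a b \<or> a = b"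

definition acceptable :: "('f \<times> 'w) set" where
  "acceptable = {(f, w). prefF f {w} {} \<and> prefW w (Some f) None}"

text \<open>
  A matching is represented by its firm side \<open>\<mu> :: 'f \<Rightarrow> 'w set\<close>; the requirement that the
  worker side be a function consistent with it is the disjointness condition, and
  \<open>partner \<mu>\<close> is that function.
\<close>

definition matching :: "('f \<Rightarrow> 'w set) \<Rightarrow> bool" where
  "matching \<mu> \<longleftrightarrow> (\<forall>f. card (\<mu> f) \<le> q f) \<and> (\<forall>f g. f \<noteq> g \<longrightarrow> \<mu> f \<inter> \<mu> g = {})"

definition partner :: "('f \<Rightarrow> 'w set) \<Rightarrow> 'w \<Rightarrow> 'f option" where
  "partner \<mu> w = (if \<exists>f. w \<in> \<mu> f then Some (THE f. w \<in> \<mu> f) else None)"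

definition individually_rational :: "('f \<Rightarrow> 'w set) \<Rightarrow> bool" where
  "individually_rational \<mu> \<longleftrightarrow> (\<forall>f w. w \<in> \<mu> f \<longrightarrow> (f, w) \<in> acceptable)"

definition blocks :: "'f \<Rightarrow> 'w \<Rightarrow> ('f \<Rightarrow> 'w set) \<Rightarrow> bool" where
  "blocks f w \<mu> \<longleftrightarrow> partner \<mu> w \<noteq> Some f \<and> prefW w (Some f) (partner \<mu> w) \<and>
    (card (\<mu> f) = q f \<and> (\<exists>w'\<in>\<mu> f. prefF f {w} {w'}) \<or>
     card (\<mu> f) < q f \<and> prefF f {w} {})"

definition stable_matchings :: "('f \<Rightarrow> 'w set) set" where
  "stable_matchings =
    {\<mu>. matching \<mu> \<and> individually_rational \<mu> \<and> \<not> (\<exists>f w. blocks f w \<mu>)}"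

definition incidence :: "('f \<Rightarrow> 'w set) \<Rightarrow> real ^ 'w ^ 'f" where
  "incidence \<mu> = (\<chi> f w. if partner \<mu> w = Some f then 1 else 0)"

definition worker_optimal :: "'f \<Rightarrow> 'w set" where
  "worker_optimal = (THE \<mu>. \<mu> \<in> stable_matchings \<and>
    (\<forall>\<nu>\<in>stable_matchings. \<forall>w. weakW w (partner \<mu> w) (partner \<nu> w)))"

definition CP :: "(real ^ 'w ^ 'f) set" where
  "CP = {x. (\<forall>f. (\<Sum>j\<in>UNIV. x $ f $ j) \<le> real (q f)) \<and>
            (\<forall>w. (\<Sum>i\<in>UNIV. x $ i $ w) \<le> 1) \<and>
            (\<forall>f w. 0 \<le> x $ f $ w) \<and>
            (\<forall>f w. (f, w) \<notin> acceptable \<longrightarrow> x $ f $ w = 0)}"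

definition SSF :: "(real ^ 'w ^ 'f) set" where
  "SSF = {x \<in> CP. \<forall>(f, w) \<in> acceptable.
    (real (q f) - (\<Sum>j | weakF f j w. x $ f $ j)) *
    (1 - (\<Sum>i | weakW w (Some i) (Some f). x $ i $ w)) = 0}"

definition most_preferred :: "'f \<Rightarrow> 'w set \<Rightarrow> 'w" where
  "most_preferred f T = (THE w. w \<in> T \<and> (\<forall>w'\<in>T. weakF f w w'))"

definition least_preferred :: "'f \<Rightarrow> 'w set \<Rightarrow> 'w" where
  "least_preferred f T = (THE w. w \<in> T \<and> (\<forall>w'\<in>T. weakF f w' w))"

text \<open>
  The lists of the reduced profile of \<open>\<mu>\<close> are represented by the sets of their entries; the
  order of the entries is always that of the original preferences. The removals of the first
  two steps do not interact, so they are carried out together on each side of the market.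
  After the third step \<open>w\<close> is on the list of \<open>f\<close> iff \<open>f\<close> is on the list of \<open>w\<close>, so the lists of
  the firms (\<open>firm_list\<close>) determine the reduced profile.
\<close>

definition firm_list12 :: "('f \<Rightarrow> 'w set) \<Rightarrow> 'f \<Rightarrow> 'w set" where
  "firm_list12 \<mu> f = {w. prefF f {w} {}}
     - {w. \<mu> f \<noteq> {} \<and> prefF f {w} {most_preferred f (\<mu> f)}}
     - {w. worker_optimal f \<noteq> {} \<and> prefF f {least_preferred f (worker_optimal f)} {w}}"

definition worker_list12 :: "('f \<Rightarrow> 'w set) \<Rightarrow> 'w \<Rightarrow> 'f set" where
  "worker_list12 \<mu> w = {f. prefW w (Some f) None}
     - {f. prefW w (Some f) (partner worker_optimal w)}
     - {f. prefW w (partner \<mu> w) (Some f)}"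

definition firm_list :: "('f \<Rightarrow> 'w set) \<Rightarrow> 'f \<Rightarrow> 'w set" where
  "firm_list \<mu> f = {w \<in> firm_list12 \<mu> f. f \<in> worker_list12 \<mu> w}"

text \<open>The worker \<open>w\<^sub>f\<close> of a firm \<open>f\<close> of a cycle.\<close>

definition next_worker :: "('f \<Rightarrow> 'w set) \<Rightarrow> 'f \<Rightarrow> 'w" where
  "next_worker \<mu> f = most_preferred f (firm_list \<mu> f - \<mu> f)"

definition cycles :: "('f \<Rightarrow> 'w set) \<Rightarrow> 'f set set" where
  "cycles \<mu> = {set es | es. es \<noteq> [] \<and> distinct es \<and>
    (\<forall>d < length es. firm_list \<mu> (es ! d) - \<mu> (es ! d) \<noteq> {} \<and>
       next_worker \<mu> (es ! d) \<in> \<mu> (es ! (Suc d mod length es)))}"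

text \<open>
  The predecessor \<open>e\<^sub>d\<^sub>-\<^sub>1\<close> of \<open>e\<^sub>d\<close> in a cycle is the only firm of the cycle whose next worker is
  in \<open>\<mu> e\<^sub>d\<close>, since the sets \<open>\<mu> e\<close> are disjoint and the cycle has no repetitions.
\<close>

definition cycle_pred :: "('f \<Rightarrow> 'w set) \<Rightarrow> 'f set \<Rightarrow> 'f \<Rightarrow> 'f" where
  "cycle_pred \<mu> \<sigma> f = (THE e. e \<in> \<sigma> \<and> next_worker \<mu> e \<in> \<mu> f)"

definition cyclic_matching :: "('f \<Rightarrow> 'w set) \<Rightarrow> 'f set \<Rightarrow> 'f \<Rightarrow> 'w set" where
  "cyclic_matching \<mu> \<sigma> f =
    (if f \<in> \<sigma> then (\<mu> f - {next_worker \<mu> (cycle_pred \<mu> \<sigma> f)}) \<union> {next_worker \<mu> f} else \<mu> f)"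

text \<open>Distinct cycles are disjoint, so the description below picks out the cycle containing \<open>f\<close>.\<close>

definition multi_cyclic_matching :: "('f \<Rightarrow> 'w set) \<Rightarrow> 'f set set \<Rightarrow> 'f \<Rightarrow> 'w set" where
  "multi_cyclic_matching \<mu> K f =
    (if \<exists>\<sigma>\<in>K. f \<in> \<sigma> then cyclic_matching \<mu> (THE \<sigma>. \<sigma> \<in> K \<and> f \<in> \<sigma>) f else \<mu> f)"

definition cyclic_family :: "('f \<Rightarrow> 'w set) \<Rightarrow> ('f \<Rightarrow> 'w set) set" where
  "cyclic_family \<mu> = {multi_cyclic_matching \<mu> K | K. K \<subseteq> cycles \<mu>}"

end

end

theory Submission imports Defs begin

text \<open>
  Let \<open>x\<close> be strongly stable. Every entry in the support is the last one in its row, with the quota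
  exhausted, or the last one in its column, with the worker fully matched. Entries strictly between
  \<open>0\<close> and \<open>1\<close> come at least in pairs in such rows and columns, so by counting they form disjoint
  cycles, on which row-last entries \<open>t\<close> and column-last entries \<open>1 - t\<close> alternate. The column-last
  entries of the support form a stable matching \<open>\<mu>\<close>, the fractional row-last entries give the
  next workers of \<open>\<mu>\<close>, and \<open>x\<close> arises from \<open>\<mu>\<close> by carrying out each cycle with its weight \<open>t\<close>.
  It is thus a point of a cube whose vertices are the matchings \<open>\<mu>[K]\<close>. Conversely, the matchings
  \<open>\<mu>[K]\<close> satisfy the complementarity conditions with the same vanishing factors.
\<close>

text \<open>The obstacle is that cycles live in the reduced profile, whose cut-offs refer to the
  worker-optimal matching, about which \<open>x\<close> says nothing. The bridge is formed by
  \<open>rotating\<close> sets of firms, which are free of cut-offs and indices and closed under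
  unions. That no cut-off hides a firm of such a set rests on joins of stable matchings and on each
  firm having equally many workers in all of them. The alternating weights come from integrality: an
  exhausted row or column has an integral sum, so a fractional entry there needs a fractional
  companion, and exactly two of them add up to 1. For the converse, \<open>SSF\<close> is given by
  products, so convexity becomes available only once the vanishing factor of each product is
  fixed.\<close>

context market
begin

lemma prefF_asym: "prefF f S T \<Longrightarrow> \<not> prefF f T S"
  using prefF_linear(1,2)[of f] by (metis irreflpD transpD)

lemma prefF_trans: "prefF f S T \<Longrightarrow> prefF f T U \<Longrightarrow> prefF f S U"
  using prefF_linear(2)[of f] by (metis transpD)

lemma prefW_asym: "prefW w a b \<Longrightarrow> \<not> prefW w b a"
  using prefW_linear(1,2)[of w] by (metis irreflpD transpD)

lemma prefW_irrefl [simp]: "\<not> prefW w a a"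
  using prefW_asym by metis

lemma prefW_trans: "prefW w a b \<Longrightarrow> prefW w b c \<Longrightarrow> prefW w a c"
  using prefW_linear(2)[of w] by (metis transpD)

lemma weakF_refl [simp]: "weakF f w w"
  by (simp add: weakF_def)

lemma weakF_trans: "weakF f a b \<Longrightarrow> weakF f b c \<Longrightarrow> weakF f a c"
  unfolding weakF_def using prefF_trans by metis

lemma not_weakF: "\<not> weakF f a b \<longleftrightarrow> prefF f {b} {a}"
  unfolding weakF_def using prefF_asym prefF_linear(3)[of f]
  by (metis singleton_inject totalpD)

lemma weakF_antisym: "weakF f a b \<Longrightarrow> weakF f b a \<Longrightarrow> a = b"
  unfolding weakF_def using prefF_asym by metis

lemma weakW_refl [simp]: "weakW w a a"
  by (simp add: weakW_def)

lemma weakW_trans: "weakW w a b \<Longrightarrow> weakW w b c \<Longrightarrow> weakW w a c"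
  unfolding weakW_def using prefW_trans by metis

lemma not_weakW: "\<not> weakW w a b \<longleftrightarrow> prefW w b a"
  unfolding weakW_def using prefW_asym prefW_linear(3)[of w]
  by (metis totalpD)

lemma weakW_antisym: "weakW w a b \<Longrightarrow> weakW w b a \<Longrightarrow> a = b"
  unfolding weakW_def using prefW_asym by metis

lemma ex_most_preferred:
  assumes "T \<noteq> {}"
  shows "\<exists>w\<in>T. \<forall>w'\<in>T. weakF f w w'"
proof -
  have "finite T" by simp
  from this assms show ?thesis
  proof (induction T rule: finite_ne_induct)
    case (insert x T)
    then show ?case by (metis insert_iff not_weakF weakF_def weakF_refl weakF_trans)
  qed simp
qed

lemma ex_least_preferred:
  assumes "T \<noteq> {}"
  shows "\<exists>w\<in>T. \<forall>w'\<in>T. weakF f w' w"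
proof -
  have "finite T" by simp
  from this assms show ?thesis
  proof (induction T rule: finite_ne_induct)
    case (insert x T)
    then show ?case by (metis insert_iff not_weakF weakF_def weakF_refl weakF_trans)
  qed simp
qed

lemma most_preferred_eq:
  assumes "w \<in> T" and "\<And>w'. w' \<in> T \<Longrightarrow> weakF f w w'"
  shows "most_preferred f T = w"
  unfolding most_preferred_def
  by (rule the_equality) (use assms weakF_antisym in blast)+

lemma least_preferred_eq:
  assumes "w \<in> T" and "\<And>w'. w' \<in> T \<Longrightarrow> weakF f w' w"
  shows "least_preferred f T = w"
  unfolding least_preferred_def
  by (rule the_equality) (use assms weakF_antisym in blast)+

lemma most_preferred:
  assumes "T \<noteq> {}"
  shows "most_preferred f T \<in> T" and "w \<in> T \<Longrightarrow> weakF f (most_preferred f T) w"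
  using ex_most_preferred[OF assms, of f] most_preferred_eq by metis+

lemma least_preferred:
  assumes "T \<noteq> {}"
  shows "least_preferred f T \<in> T" and "w \<in> T \<Longrightarrow> weakF f w (least_preferred f T)"
  using ex_least_preferred[OF assms, of f] least_preferred_eq by metis+

section \<open>Partners and working forms of stability\<close>

lemma partner_eq_Some:
  assumes "matching \<mu>"
  shows "partner \<mu> w = Some f \<longleftrightarrow> w \<in> \<mu> f"
proof
  assume "w \<in> \<mu> f"
  then have "(THE f. w \<in> \<mu> f) = f"
    using assms unfolding matching_def by (intro the_equality) blast+
  then show "partner \<mu> w = Some f"
    using \<open>w \<in> \<mu> f\<close> unfolding partner_def by auto
next
  assume "partner \<mu> w = Some f"
  then obtain g where g: "w \<in> \<mu> g" and f: "f = (THE f. w \<in> \<mu> f)"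
    unfolding partner_def by (auto split: if_splits)
  have "(THE f. w \<in> \<mu> f) = g"
    using assms g unfolding matching_def by (intro the_equality) blast+
  with g f show "w \<in> \<mu> f" by simp
qed

lemma partner_eq_None: "partner \<mu> w = None \<longleftrightarrow> (\<forall>f. w \<notin> \<mu> f)"
  unfolding partner_def by simp

lemma stableD:
  assumes "\<mu> \<in> stable_matchings"
  shows "matching \<mu>" "w \<in> \<mu> f \<Longrightarrow> (f, w) \<in> acceptable"
    "partner \<mu> w = Some f \<longleftrightarrow> w \<in> \<mu> f" "card (\<mu> f) \<le> q f"
proof -
  show m: "matching \<mu>"
    using assms unfolding stable_matchings_def by simp
  show "w \<in> \<mu> f \<Longrightarrow> (f, w) \<in> acceptable"
    using assms unfolding stable_matchings_def individually_rational_def by simp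
  show "partner \<mu> w = Some f \<longleftrightarrow> w \<in> \<mu> f"
    by (rule partner_eq_Some[OF m])
  show "card (\<mu> f) \<le> q f"
    using m unfolding matching_def by simp
qed

text \<open>If \<open>w\<close> would rather be at \<open>f\<close>, the only way not to block is
  that \<open>f\<close> is full of workers ranked above \<open>w\<close>. The ranking is strict
  because \<open>w\<close> itself is not at \<open>f\<close>.\<close>

lemma stable_full:
  assumes "\<mu> \<in> stable_matchings" and "(f, w) \<in> acceptable" and "prefW w (Some f) (partner \<mu> w)"
  shows "card (\<mu> f) = q f" and "j \<in> \<mu> f \<Longrightarrow> prefF f {j} {w}"
proof -
  have nb: "\<not> blocks f w \<mu>" and c: "card (\<mu> f) \<le> q f"
    using assms(1) unfolding stable_matchings_def matching_def by auto
  have ne: "partner \<mu> w \<noteq> Some f"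
    using assms(3) prefW_asym by metis
  have "prefF f {w} {}"
    using assms(2) unfolding acceptable_def by simp
  with nb ne assms(3) have "\<not> card (\<mu> f) < q f"
    unfolding blocks_def by blast
  with c show full: "card (\<mu> f) = q f" by simp
  assume j: "j \<in> \<mu> f"
  have "weakF f j w"
    using nb ne assms(3) full j not_weakF unfolding blocks_def by blast
  moreover have "j \<noteq> w"
    using ne j stableD(3)[OF assms(1)] by blast
  ultimately show "prefF f {j} {w}"
    by (simp add: weakF_def)
qed

text \<open>Testing acceptable pairs suffices, since a blocking pair is acceptable: \<open>f\<close>
  ranks \<open>w\<close> above the empty set, directly or through an acceptable worker of its own,
  and \<open>w\<close> ranks \<open>f\<close> above a partner no worse than being unmatched.\<close>

lemma stableI:
  assumes "matching \<mu>" and acc: "\<And>f w. w \<in> \<mu> f \<Longrightarrow> (f, w) \<in> acceptable"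
    and full: "\<And>f w. (f, w) \<in> acceptable \<Longrightarrow> prefW w (Some f) (partner \<mu> w) \<Longrightarrow>
      card (\<mu> f) = q f \<and> (\<forall>j\<in>\<mu> f. weakF f j w)"
  shows "\<mu> \<in> stable_matchings"
proof -
  have "\<not> blocks f w \<mu>" for f w
  proof
    assume b: "blocks f w \<mu>"
    then have p: "prefW w (Some f) (partner \<mu> w)"
      unfolding blocks_def by simp
    have a: "prefF f {w} {}"
      using b acc prefF_trans unfolding blocks_def acceptable_def by blast
    have "prefW w (Some f) None"
    proof (cases "partner \<mu> w")
      case (Some g)
      then have "prefW w (Some g) None"
        using acc partner_eq_Some[OF assms(1)] unfolding acceptable_def by auto
      with Some p show ?thesis using prefW_trans by metis
    qed (use p in simp)
    with a have "(f, w) \<in> acceptable" unfolding acceptable_def by simp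
    from full[OF this p] b show False
      unfolding blocks_def using not_weakF by auto
  qed
  then show ?thesis
    using assms(1) acc unfolding stable_matchings_def individually_rational_def by simp
qed

subsection \<open>Joins and the worker-optimal stable matching\<close>

text \<open>Each worker takes the better of its two partners: the join in the lattice of stable
  matchings ordered by the workers.\<close>

definition join :: "('f \<Rightarrow> 'w set) \<Rightarrow> ('f \<Rightarrow> 'w set) \<Rightarrow> 'f \<Rightarrow> 'w set" where
  "join \<mu> \<nu> f = {w \<in> \<mu> f. weakW w (Some f) (partner \<nu> w)} \<union>
    {w \<in> \<nu> f. weakW w (Some f) (partner \<mu> w)}"

lemma partner_weak_None:
  assumes "\<mu> \<in> stable_matchings"
  shows "weakW w (partner \<mu> w) None"
proof (cases "partner \<mu> w")
  case (Some f)
  then have "(f, w) \<in> acceptable"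
    using stableD(2,3)[OF assms] by blast
  then show ?thesis
    using Some unfolding acceptable_def weakW_def by simp
qed simp

text \<open>Stability of \<open>\<nu>\<close> puts all of \<open>\<nu> f\<close> above
  \<open>w\<close>, and stability of \<open>\<mu>\<close> puts all of \<open>\<mu> f\<close> above
  \<open>v\<close>, so \<open>v\<close> and \<open>w\<close> would each rank above the
  other.\<close>

lemma join_disjoint:
  assumes "\<mu> \<in> stable_matchings" "\<nu> \<in> stable_matchings"
    and "w \<in> \<mu> f" "prefW w (Some f) (partner \<nu> w)"
    and "v \<in> \<nu> f" "prefW v (Some f) (partner \<mu> v)"
  shows False
proof -
  have "prefF f {v} {w}"
    using stable_full(2)[OF assms(2) _ assms(4,5)] stableD(2)[OF assms(1,3)] by simp
  moreover have "prefF f {w} {v}"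
    using stable_full(2)[OF assms(1) _ assms(6,3)] stableD(2)[OF assms(2,5)] by simp
  ultimately show False using prefF_asym by blast
qed

text \<open>
  The workers who strictly gain from \<open>\<nu>\<close> to \<open>\<mu>\<close> are all matched under \<open>\<mu>\<close>, and a firm
  that employs one of them under \<open>\<mu>\<close> is full under \<open>\<nu>\<close>. Counting them by their firms under
  \<open>\<mu>\<close> and under \<open>\<nu>\<close> forces equality firm by firm.
\<close>

lemma card_gainers:
  assumes "\<mu> \<in> stable_matchings" "\<nu> \<in> stable_matchings"
  shows "card {w \<in> \<mu> f. prefW w (partner \<mu> w) (partner \<nu> w)} =
    card {w \<in> \<nu> f. prefW w (partner \<mu> w) (partner \<nu> w)}"
proof -
  define X where "X = {w. prefW w (partner \<mu> w) (partner \<nu> w)}"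
  define a b where "a f = card (\<mu> f \<inter> X)" and "b f = card (\<nu> f \<inter> X)" for f
  have le: "a g \<le> b g" for g
  proof (cases "\<mu> g \<inter> X = {}")
    case False
    then obtain w where w: "w \<in> \<mu> g" "prefW w (Some g) (partner \<nu> w)"
      using stableD(3)[OF assms(1), THEN iffD2] unfolding X_def by fastforce
    then have "card (\<nu> g) = q g"
      using stable_full(1)[OF assms(2)] stableD(2)[OF assms(1)] by blast
    then have c: "card (\<mu> g) \<le> card (\<nu> g)"
      using stableD(4)[OF assms(1)] by simp
    \<comment> \<open>Given one gainer \<open>w\<close> at \<open>g\<close>,
      \<open>join_disjoint\<close> forbids any worker of \<open>\<nu> g\<close> to lose; those
      outside \<open>X\<close> therefore stay at \<open>g\<close>.\<close>
    have "\<nu> g - X \<subseteq> \<mu> g - X"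
    proof
      fix v assume v: "v \<in> \<nu> g - X"
      then have pv: "partner \<nu> v = Some g" using stableD(3)[OF assms(2)] by blast
      have "\<not> prefW v (Some g) (partner \<mu> v)"
        using join_disjoint[OF assms w] v by blast
      then have "weakW v (partner \<mu> v) (partner \<nu> v)"
        using pv not_weakW by auto
      then have "partner \<mu> v = Some g"
        using v pv unfolding X_def weakW_def by auto
      then show "v \<in> \<mu> g - X" using v stableD(3)[OF assms(1)] by blast
    qed
    then have "card (\<nu> g - X) \<le> card (\<mu> g - X)" by (intro card_mono) auto
    moreover have "card (\<mu> g) = a g + card (\<mu> g - X)" "card (\<nu> g) = b g + card (\<nu> g - X)"
      unfolding a_def b_def
      by (metis card_Int_Diff add.commute finite)+
    ultimately show ?thesis using c by simp
  qed (simp add: a_def)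
  have cU: "(\<Sum>g\<in>UNIV. card (\<kappa> g \<inter> X)) = card (\<Union>g. \<kappa> g \<inter> X)" if "matching \<kappa>" for \<kappa>
  proof (rule card_UN_disjoint[symmetric])
    show "\<forall>i\<in>UNIV. \<forall>j\<in>UNIV. i \<noteq> j \<longrightarrow> \<kappa> i \<inter> X \<inter> (\<kappa> j \<inter> X) = {}"
    proof (intro ballI impI)
      fix i j :: 'f assume "i \<noteq> j"
      then have "\<kappa> i \<inter> \<kappa> j = {}" using that unfolding matching_def by simp
      then show "\<kappa> i \<inter> X \<inter> (\<kappa> j \<inter> X) = {}" by blast
    qed
  qed simp_all
  have "(\<Sum>g\<in>UNIV. a g) = card (\<Union>g. \<mu> g \<inter> X)"
    unfolding a_def by (rule cU[OF stableD(1)[OF assms(1)]])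
  moreover have "(\<Sum>g\<in>UNIV. b g) = card (\<Union>g. \<nu> g \<inter> X)"
    unfolding b_def by (rule cU[OF stableD(1)[OF assms(2)]])
  moreover have "card (\<Union>g. \<nu> g \<inter> X) \<le> card (\<Union>g. \<mu> g \<inter> X)"
  proof (rule card_mono)
    show "(\<Union>g. \<nu> g \<inter> X) \<subseteq> (\<Union>g. \<mu> g \<inter> X)"
    proof
      fix w assume "w \<in> (\<Union>g. \<nu> g \<inter> X)"
      then have w: "w \<in> X" by blast
      have "partner \<mu> w \<noteq> None"
      proof
        assume "partner \<mu> w = None"
        then have "prefW w None (partner \<nu> w)" using w unfolding X_def by simp
        then show False using partner_weak_None[OF assms(2), of w] not_weakW by blast
      qed
      then show "w \<in> (\<Union>g. \<mu> g \<inter> X)"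
        using w partner_eq_None by auto
    qed
  qed simp
  ultimately have "(\<Sum>g\<in>UNIV. b g) \<le> (\<Sum>g\<in>UNIV. a g)" by simp
  then have "\<not> a f < b f"
    using le sum_strict_mono_ex1[of UNIV a b] by (meson UNIV_I finite not_less)
  with le[of f] have "a f = b f" by simp
  then show ?thesis
    by (simp add: a_def b_def X_def Int_def)
qed

text \<open>The workers of \<open>f\<close> split into gainers, losers and those common to both
  matchings; \<open>card_gainers\<close>, used in both directions, matches the first two classes.
  Equal sizes are part of the rural hospitals theorem.\<close>

lemma card_join:
  assumes "\<mu> \<in> stable_matchings" "\<nu> \<in> stable_matchings"
  shows "card (\<nu> f) = card (\<mu> f)" and "card (join \<mu> \<nu> f) = card (\<mu> f)"
proof -
  let ?A = "{w \<in> \<mu> f. prefW w (partner \<mu> w) (partner \<nu> w)}"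
  let ?A' = "{w \<in> \<nu> f. prefW w (partner \<mu> w) (partner \<nu> w)}"
  let ?B = "{w \<in> \<mu> f. prefW w (partner \<nu> w) (partner \<mu> w)}"
  let ?B' = "{w \<in> \<nu> f. prefW w (partner \<nu> w) (partner \<mu> w)}"
  note s = stableD(3)[OF assms(1)] stableD(3)[OF assms(2)]
  have 1: "card ?A = card ?A'" "card ?B' = card ?B"
    using card_gainers assms by blast+
  have card3: "card (A \<union> B \<union> C) = card A + card B + card C"
    if "\<And>w. w \<in> A \<Longrightarrow> w \<notin> B \<and> w \<notin> C" "\<And>w. w \<in> B \<Longrightarrow> w \<notin> C" for A B C :: "'w set"
    using that by (subst card_Un_disjoint; (subst card_Un_disjoint)?) auto
  have tri: "weakW w a b \<longleftrightarrow> prefW w a b \<or> a = b" for w a b by (simp add: weakW_def)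
  have "\<mu> f = ?A \<union> ?B \<union> (\<mu> f \<inter> \<nu> f)"
    using s not_weakW tri by (auto, metis)
  then have "card (\<mu> f) = card (?A \<union> ?B \<union> (\<mu> f \<inter> \<nu> f))" by simp
  also have "\<dots> = card ?A + card ?B + card (\<mu> f \<inter> \<nu> f)"
    by (rule card3) (auto simp: s[of _ f, THEN iffD2] dest: prefW_asym)
  finally have 2: "card (\<mu> f) = card ?A + card ?B + card (\<mu> f \<inter> \<nu> f)" .
  have "\<nu> f = ?A' \<union> ?B' \<union> (\<mu> f \<inter> \<nu> f)"
    using s not_weakW tri by (auto, metis)
  then have "card (\<nu> f) = card (?A' \<union> ?B' \<union> (\<mu> f \<inter> \<nu> f))" by simp
  also have "\<dots> = card ?A' + card ?B' + card (\<mu> f \<inter> \<nu> f)"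
    by (rule card3) (auto simp: s[of _ f, THEN iffD2] dest: prefW_asym)
  finally show "card (\<nu> f) = card (\<mu> f)" using 1 2 by simp
  have "join \<mu> \<nu> f = ?A \<union> ?B' \<union> (\<mu> f \<inter> \<nu> f)"
    unfolding join_def by (auto simp: s[symmetric] weakW_def)
  then have "card (join \<mu> \<nu> f) = card (?A \<union> ?B' \<union> (\<mu> f \<inter> \<nu> f))" by simp
  also have "\<dots> = card ?A + card ?B' + card (\<mu> f \<inter> \<nu> f)"
    by (rule card3) (auto simp: s[of _ f, THEN iffD2] dest: prefW_asym)
  finally show "card (join \<mu> \<nu> f) = card (\<mu> f)" using 1 2 by simp
qed

text \<open>A worker who prefers \<open>f\<close> to its partner in the join prefers
  \<open>f\<close> to both partners, so \<open>f\<close> is full in both matchings with workers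
  ranked above; \<open>card_join\<close> carries fullness over to the join.\<close>

lemma join_stable:
  assumes "\<mu> \<in> stable_matchings" "\<nu> \<in> stable_matchings"
  shows "join \<mu> \<nu> \<in> stable_matchings"
    and "weakW w (partner (join \<mu> \<nu>) w) (partner \<mu> w)"
    and "weakW w (partner (join \<mu> \<nu>) w) (partner \<nu> w)"
proof -
  note s = stableD(3)[OF assms(1)] stableD(3)[OF assms(2)]
  have m: "matching (join \<mu> \<nu>)"
    unfolding matching_def
  proof (intro conjI allI impI)
    show "card (join \<mu> \<nu> f) \<le> q f" for f
      using card_join(2)[OF assms] stableD(4)[OF assms(1)] by simp
    fix f g :: 'f assume "f \<noteq> g"
    have "f = g" if "w \<in> join \<mu> \<nu> f" "w \<in> join \<mu> \<nu> g" for w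
    proof -
      have "partner \<mu> w = Some f \<and> weakW w (Some f) (partner \<nu> w) \<or>
          partner \<nu> w = Some f \<and> weakW w (Some f) (partner \<mu> w)"
        "partner \<mu> w = Some g \<and> weakW w (Some g) (partner \<nu> w) \<or>
          partner \<nu> w = Some g \<and> weakW w (Some g) (partner \<mu> w)"
        using that s unfolding join_def by blast+
      then show "f = g" using weakW_antisym[of w "Some f" "Some g"] by auto
    qed
    with \<open>f \<noteq> g\<close> show "join \<mu> \<nu> f \<inter> join \<mu> \<nu> g = {}" by blast
  qed
  have both: "weakW w (partner (join \<mu> \<nu>) w) (partner \<mu> w) \<and>
    weakW w (partner (join \<mu> \<nu>) w) (partner \<nu> w)" for w
  proof (cases "partner (join \<mu> \<nu>) w")
    case (Some f)
    then have "w \<in> join \<mu> \<nu> f" using partner_eq_Some[OF m] by simp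
    then have "partner \<mu> w = Some f \<and> weakW w (Some f) (partner \<nu> w) \<or>
        partner \<nu> w = Some f \<and> weakW w (Some f) (partner \<mu> w)"
      using s unfolding join_def by blast
    then show ?thesis using Some by auto
  next
    case None
    then have n: "w \<notin> join \<mu> \<nu> f" for f using partner_eq_None by blast
    have "partner \<mu> w = None \<and> partner \<nu> w = None"
    proof (cases "weakW w (partner \<mu> w) (partner \<nu> w)")
      case True
      then have "partner \<mu> w = None"
        using n s unfolding join_def by (cases "partner \<mu> w") auto
      with True show ?thesis
        using partner_weak_None[OF assms(2)] weakW_antisym by metis
    next
      case False
      then have F: "weakW w (partner \<nu> w) (partner \<mu> w)"
        using not_weakW weakW_def by blast
      then have "partner \<nu> w = None"
        using n s unfolding join_def by (cases "partner \<nu> w") auto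
      with F show ?thesis
        using partner_weak_None[OF assms(1)] weakW_antisym by metis
    qed
    with None show ?thesis by simp
  qed
  then show "weakW w (partner (join \<mu> \<nu>) w) (partner \<mu> w)"
    "weakW w (partner (join \<mu> \<nu>) w) (partner \<nu> w)" by auto
  show "join \<mu> \<nu> \<in> stable_matchings"
  proof (rule stableI[OF m])
    show "(f, w) \<in> acceptable" if "w \<in> join \<mu> \<nu> f" for f w
      using that stableD(2)[OF assms(1)] stableD(2)[OF assms(2)] unfolding join_def by blast
    fix f w assume a: "(f, w) \<in> acceptable" and p: "prefW w (Some f) (partner (join \<mu> \<nu>) w)"
    have p1: "prefW w (Some f) (partner \<mu> w)" and p2: "prefW w (Some f) (partner \<nu> w)"
      using p both[of w] prefW_trans unfolding weakW_def by metis+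
    show "card (join \<mu> \<nu> f) = q f \<and> (\<forall>j\<in>join \<mu> \<nu> f. weakF f j w)"
      using card_join(2)[OF assms] stable_full[OF assms(1) a p1] stable_full[OF assms(2) a p2]
      unfolding join_def weakF_def by auto
  qed
qed

text \<open>The description is well defined: the stable matchings are finitely many, joining them
  one by one gives an upper bound, and antisymmetry makes it unique. The given \<open>\<mu>\<close>
  starts the induction.\<close>

lemma worker_optimal:
  assumes "\<mu> \<in> stable_matchings"
  shows "worker_optimal \<in> stable_matchings"
    and "\<nu> \<in> stable_matchings \<Longrightarrow> weakW w (partner worker_optimal w) (partner \<nu> w)"
proof -
  let ?top = "\<lambda>S \<mu>. \<mu> \<in> stable_matchings \<and> (\<forall>\<nu>\<in>S. \<forall>w. weakW w (partner \<mu> w) (partner \<nu> w))"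
  have fin: "finite (stable_matchings :: ('f \<Rightarrow> 'w set) set)" by simp
  have "\<exists>\<mu>. ?top S \<mu>" if "finite S" "S \<subseteq> stable_matchings" for S
    using that
  proof (induction S rule: finite_induct)
    case empty
    then show ?case using assms by auto
  next
    case (insert \<nu> S)
    then obtain \<theta> where l: "?top S \<theta>" by auto
    have "?top (insert \<nu> S) (join \<nu> \<theta>)"
      using join_stable[of \<nu> \<theta>] l insert.prems weakW_trans by blast
    then show ?case by blast
  qed
  from this[OF fin] obtain \<theta> where l: "?top stable_matchings \<theta>" by auto
  have "worker_optimal = \<theta>"
    unfolding worker_optimal_def
  proof (rule the_equality, rule l)
    fix \<kappa> assume k: "?top stable_matchings \<kappa>"
    then have "partner \<kappa> w = partner \<theta> w" for w
      using l weakW_antisym by blast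
    then show "\<kappa> = \<theta>"
      using stableD(3) k l by (intro ext set_eqI) metis
  qed
  with l show "worker_optimal \<in> stable_matchings"
    "\<nu> \<in> stable_matchings \<Longrightarrow> weakW w (partner worker_optimal w) (partner \<nu> w)" by auto
qed

end

subsection \<open>Rotations of a stable matching\<close>

context market
begin

text \<open>
  \<open>wanted\<close> and \<open>best_wanted\<close> ignore the cut-offs of the reduced profile; on cycles
  \<open>best_wanted\<close> agrees with \<open>next_worker\<close>. A set of firms is \<open>rotating\<close> if mapping each firm to
  the employer of its best wanted worker permutes it, i.e. if it is a union of cycles.
\<close>

definition wanted :: "('f \<Rightarrow> 'w set) \<Rightarrow> 'f \<Rightarrow> 'w set" where
  "wanted \<mu> f = {w. (f, w) \<in> acceptable \<and> prefW w (Some f) (partner \<mu> w)}"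

definition best_wanted :: "('f \<Rightarrow> 'w set) \<Rightarrow> 'f \<Rightarrow> 'w" where
  "best_wanted \<mu> f = most_preferred f (wanted \<mu> f)"

definition rotating :: "('f \<Rightarrow> 'w set) \<Rightarrow> 'f set \<Rightarrow> bool" where
  "rotating \<mu> U \<longleftrightarrow> (\<forall>f\<in>U. wanted \<mu> f \<noteq> {}) \<and>
    (\<lambda>f. partner \<mu> (best_wanted \<mu> f)) ` U = Some ` U"

text \<open>Subtracting the best wanted workers of all of \<open>U\<close> avoids naming
  predecessors in a cycle: for rotating \<open>U\<close> it removes exactly one worker from each
  firm of \<open>U\<close> and none elsewhere.\<close>

definition shift :: "('f \<Rightarrow> 'w set) \<Rightarrow> 'f set \<Rightarrow> 'f \<Rightarrow> 'w set" where
  "shift \<mu> U f = (\<mu> f - best_wanted \<mu> ` U) \<union> (if f \<in> U then {best_wanted \<mu> f} else {})"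

lemma best_wanted:
  assumes "wanted \<mu> f \<noteq> {}"
  shows "(f, best_wanted \<mu> f) \<in> acceptable"
    and "prefW (best_wanted \<mu> f) (Some f) (partner \<mu> (best_wanted \<mu> f))"
    and "w \<in> wanted \<mu> f \<Longrightarrow> weakF f (best_wanted \<mu> f) w"
  using most_preferred[OF assms, where f = f] unfolding best_wanted_def[symmetric]
  by (auto simp: wanted_def)

lemma rotating_Union:
  assumes "\<And>U. U \<in> K \<Longrightarrow> rotating \<mu> U"
  shows "rotating \<mu> (\<Union>K)"
proof -
  have "(\<lambda>f. partner \<mu> (best_wanted \<mu> f)) ` (\<Union>K) = Some ` (\<Union>K)"
    unfolding image_Union using assms unfolding rotating_def by simp
  then show ?thesis
    using assms unfolding rotating_def by auto
qed

text \<open>A map from the finite set \<open>U\<close> onto a set of the same size is injective, and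
  \<open>best_wanted\<close> is its inner factor.\<close>

lemma rotating_inj:
  assumes "rotating \<mu> U"
  shows "inj_on (\<lambda>f. partner \<mu> (best_wanted \<mu> f)) U" and "inj_on (best_wanted \<mu>) U"
proof -
  have "card ((\<lambda>f. partner \<mu> (best_wanted \<mu> f)) ` U) = card U"
    using assms unfolding rotating_def by (simp add: card_image)
  then show 1: "inj_on (\<lambda>f. partner \<mu> (best_wanted \<mu> f)) U"
    by (intro eq_card_imp_inj_on) simp
  show "inj_on (best_wanted \<mu>) U"
    by (rule inj_onI) (rule inj_onD[OF 1], auto)
qed

context
  fixes \<mu> U
  assumes stable: "\<mu> \<in> stable_matchings" and rot: "rotating \<mu> U"
begin

lemma Int_best_wanted_notin:
  assumes "f \<notin> U"
  shows "\<mu> f \<inter> best_wanted \<mu> ` U = {}"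
proof -
  have "f \<in> U" if "e \<in> U" "best_wanted \<mu> e \<in> \<mu> f" for e
  proof -
    have "partner \<mu> (best_wanted \<mu> e) = Some f"
      using that(2) stableD(3)[OF stable] by simp
    moreover have "partner \<mu> (best_wanted \<mu> e) \<in> Some ` U"
      using that(1) rot unfolding rotating_def by blast
    ultimately show ?thesis by auto
  qed
  with assms show ?thesis by blast
qed

lemma Int_best_wanted_in:
  assumes "f \<in> U"
  obtains e where "e \<in> U" "best_wanted \<mu> e \<in> \<mu> f"
    "\<mu> f \<inter> best_wanted \<mu> ` U = {best_wanted \<mu> e}"
proof -
  have "Some f \<in> (\<lambda>f. partner \<mu> (best_wanted \<mu> f)) ` U"
    using assms rot unfolding rotating_def by simp
  then obtain e where e: "e \<in> U" "partner \<mu> (best_wanted \<mu> e) = Some f"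
    by force
  have "e' = e" if "e' \<in> U" "best_wanted \<mu> e' \<in> \<mu> f" for e'
    using inj_onD[OF rotating_inj(1)[OF rot], of e' e] that e stableD(3)[OF stable] by simp
  moreover have "best_wanted \<mu> e \<in> \<mu> f"
    using e stableD(3)[OF stable] by simp
  ultimately show thesis using e(1) by (intro that[of e]) blast+
qed

lemma best_wanted_notin: "f \<in> U \<Longrightarrow> best_wanted \<mu> f \<notin> \<mu> f"
  using best_wanted(2)[of \<mu> f] rot stableD(3)[OF stable, of "best_wanted \<mu> f" f]
  unfolding rotating_def by fastforce

lemma card_shift: "card (shift \<mu> U f) = card (\<mu> f)"
proof (cases "f \<in> U")
  case True
  then obtain e where e: "best_wanted \<mu> e \<in> \<mu> f" "\<mu> f \<inter> best_wanted \<mu> ` U = {best_wanted \<mu> e}"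
    using Int_best_wanted_in by blast
  have "shift \<mu> U f = insert (best_wanted \<mu> f) (\<mu> f - {best_wanted \<mu> e})"
    using True e(2) unfolding shift_def by auto
  moreover have "card \<dots> = Suc (card (\<mu> f - {best_wanted \<mu> e}))"
    using best_wanted_notin[OF True] by (intro card_insert_disjoint) auto
  ultimately show ?thesis
    using e(1) by (simp only: card_Suc_Diff1 finite)
next
  case False
  then show ?thesis
    using Int_best_wanted_notin[OF False] unfolding shift_def by (simp add: Diff_triv)
qed

lemma in_shift_best_wanted: "e \<in> U \<Longrightarrow> best_wanted \<mu> e \<in> shift \<mu> U f \<longleftrightarrow> f = e"
  using inj_onD[OF rotating_inj(2)[OF rot]] unfolding shift_def by (auto split: if_splits)

lemma in_shift_other: "w \<notin> best_wanted \<mu> ` U \<Longrightarrow> w \<in> shift \<mu> U f \<longleftrightarrow> w \<in> \<mu> f"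
  unfolding shift_def by (auto split: if_splits)

lemma matching_shift: "matching (shift \<mu> U)"
  unfolding matching_def
proof (intro conjI allI impI)
  show "card (shift \<mu> U f) \<le> q f" for f
    using card_shift stableD(4)[OF stable] by simp
  fix f g :: 'f assume "f \<noteq> g"
  have "f = g" if "w \<in> shift \<mu> U f" "w \<in> shift \<mu> U g" for w
  proof (cases "w \<in> best_wanted \<mu> ` U")
    case True
    then obtain e where "e \<in> U" "w = best_wanted \<mu> e" by blast
    then show ?thesis using that in_shift_best_wanted by metis
  next
    case False
    then have "partner \<mu> w = Some f" "partner \<mu> w = Some g"
      using that in_shift_other stableD(3)[OF stable] by blast+
    then show ?thesis by simp
  qed
  with \<open>f \<noteq> g\<close> show "shift \<mu> U f \<inter> shift \<mu> U g = {}" by blast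
qed

lemma weakW_shift: "weakW w (partner (shift \<mu> U) w) (partner \<mu> w)"
proof (cases "w \<in> best_wanted \<mu> ` U")
  case True
  then obtain e where e: "e \<in> U" "w = best_wanted \<mu> e" by blast
  then have "partner (shift \<mu> U) w = Some e"
    using in_shift_best_wanted partner_eq_Some[OF matching_shift] by blast
  then show ?thesis
    using best_wanted(2)[of \<mu> e] e rot unfolding rotating_def weakW_def by auto
next
  case False
  then have "partner (shift \<mu> U) w = partner \<mu> w"
    using in_shift_other partner_eq_Some[OF matching_shift] stableD(3)[OF stable]
    by (metis option.exhaust)
  then show ?thesis by simp
qed

text \<open>The premise refers to \<open>\<mu>\<close> and not to the shifted matching, so the same
  pairs are covered for all \<open>U\<close>. Old workers rank above \<open>w\<close> by stability
  of \<open>\<mu>\<close>; the new one is the best of the wanted workers, among them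
  \<open>w\<close>.\<close>

lemma shift_full:
  assumes "(f, w) \<in> acceptable" "prefW w (Some f) (partner \<mu> w)"
  shows "card (shift \<mu> U f) = q f" and "j \<in> shift \<mu> U f \<Longrightarrow> weakF f j w"
proof -
  show "card (shift \<mu> U f) = q f"
    using card_shift stable_full(1)[OF stable assms] by simp
  assume "j \<in> shift \<mu> U f"
  then have "j \<in> \<mu> f \<or> j = best_wanted \<mu> f"
    unfolding shift_def by (auto split: if_splits)
  moreover have w: "w \<in> wanted \<mu> f"
    using assms unfolding wanted_def by simp
  then have "weakF f (best_wanted \<mu> f) w"
    using best_wanted(3) by blast
  ultimately show "weakF f j w"
    using stable_full(2)[OF stable assms] unfolding weakF_def by blast
qed

lemma shift_acceptable: "w \<in> shift \<mu> U f \<Longrightarrow> (f, w) \<in> acceptable"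
  using best_wanted(1)[of \<mu> f] stableD(2)[OF stable] rot
  unfolding shift_def rotating_def by (auto split: if_splits)

lemma shift_stable: "shift \<mu> U \<in> stable_matchings"
proof (rule stableI[OF matching_shift shift_acceptable])
  fix f w assume a: "(f, w) \<in> acceptable" and "prefW w (Some f) (partner (shift \<mu> U) w)"
  then have "prefW w (Some f) (partner \<mu> w)"
    using weakW_shift[of w] prefW_trans unfolding weakW_def by metis
  then show "card (shift \<mu> U f) = q f \<and> (\<forall>j\<in>shift \<mu> U f. weakF f j w)"
    using shift_full[OF a] by blast
qed

end

lemma incidence_nth:
  assumes "matching \<mu>"
  shows "incidence \<mu> $ f $ w = of_bool (w \<in> \<mu> f)"
  unfolding incidence_def using partner_eq_Some[OF assms] by simp

text \<open>
  In each complementarity condition, \<open>\<mu>\<close> alone selects a factor that vanishes for all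
  \<open>shift \<mu> U\<close>; so these matchings lie on a common convex subset of \<open>SSF\<close>.
\<close>

definition tight_face :: "('f \<Rightarrow> 'w set) \<Rightarrow> (real ^ 'w ^ 'f) set" where
  "tight_face \<mu> = {x \<in> CP. \<forall>(f, w) \<in> acceptable.
    if prefW w (Some f) (partner \<mu> w) then (\<Sum>j | weakF f j w. x $ f $ j) = real (q f)
    else (\<Sum>i | weakW w (Some i) (Some f). x $ i $ w) = 1}"

lemma tight_face_subset_SSF: "tight_face \<mu> \<subseteq> SSF"
  unfolding tight_face_def SSF_def by (auto split: if_splits)

lemma convex_tight_face: "convex (tight_face \<mu>)"
proof (rule convexI)
  fix x y :: "real ^ 'w ^ 'f" and u v :: real
  assume x: "x \<in> tight_face \<mu>" and y: "y \<in> tight_face \<mu>"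
    and uv: "0 \<le> u" "0 \<le> v" "u + v = 1"
  let ?z = "u *\<^sub>R x + v *\<^sub>R y"
  have F: "(\<Sum>j\<in>J. ?z $ f $ j) = u * (\<Sum>j\<in>J. x $ f $ j) + v * (\<Sum>j\<in>J. y $ f $ j)" for J f
    by (simp add: sum.distrib sum_distrib_left)
  have W: "(\<Sum>i\<in>I. ?z $ i $ w) = u * (\<Sum>i\<in>I. x $ i $ w) + v * (\<Sum>i\<in>I. y $ i $ w)" for I w
    by (simp add: sum.distrib sum_distrib_left)
  have comb: "u * c + v * c = c" for c
    using uv(3) by (metis distrib_right mult_1)
  have "?z \<in> CP"
    using x y uv unfolding tight_face_def CP_def
    by (auto simp: F W simp del: vector_add_component intro!: convex_bound_le)
      (auto simp: zero_le_mult_iff)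
  moreover have "if prefW w (Some f) (partner \<mu> w)
      then (\<Sum>j | weakF f j w. ?z $ f $ j) = real (q f)
      else (\<Sum>i | weakW w (Some i) (Some f). ?z $ i $ w) = 1" if "(f, w) \<in> acceptable" for f w
  proof -
    have "if prefW w (Some f) (partner \<mu> w) then (\<Sum>j | weakF f j w. z $ f $ j) = real (q f)
        else (\<Sum>i | weakW w (Some i) (Some f). z $ i $ w) = 1" if "z \<in> tight_face \<mu>" for z
      using that \<open>(f, w) \<in> acceptable\<close> unfolding tight_face_def by auto
    from this[OF x] this[OF y] show ?thesis
      unfolding F W by (cases "prefW w (Some f) (partner \<mu> w)") (simp_all only: if_True if_False comb)
  qed
  ultimately show "?z \<in> tight_face \<mu>"
    unfolding tight_face_def by blast
qed

text \<open>If \<open>w\<close> prefers \<open>f\<close> to its partner under \<open>\<mu>\<close>,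
  \<open>shift_full\<close> exhausts the row. Otherwise \<open>w\<close>, who does not lose by the
  shift, is matched to a firm at least as good as \<open>f\<close>, which exhausts the
  column.\<close>

lemma incidence_shift_in_tight_face:
  assumes stable: "\<mu> \<in> stable_matchings" and rot: "rotating \<mu> U"
  shows "incidence (shift \<mu> U) \<in> tight_face \<mu>"
proof -
  let ?M = "shift \<mu> U" and ?x = "incidence (shift \<mu> U)"
  note m = matching_shift[OF assms] and p = partner_eq_Some[OF matching_shift[OF assms]]
  have F: "(\<Sum>j\<in>J. ?x $ f $ j) = real (card (?M f \<inter> J))" for J f
    by (simp add: incidence_nth[OF m] sum_of_bool_eq Int_commute) 
  have W: "(\<Sum>i\<in>I. ?x $ i $ w) = (if \<exists>i\<in>I. partner ?M w = Some i then 1 else 0)" for I w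
  proof (cases "partner ?M w")
    case None
    then show ?thesis
      unfolding incidence_def by simp
  next
    case (Some g)
    then have "incidence ?M $ i $ w = (if i = g then 1 else 0)" for i
      unfolding incidence_def by auto
    with Some show ?thesis by simp
  qed
  have "?x \<in> CP"
    unfolding CP_def mem_Collect_eq F W using stableD(4)[OF shift_stable[OF assms]] shift_acceptable[OF assms]
    by (auto simp: incidence_nth[OF m])
  moreover have "if prefW w (Some f) (partner \<mu> w)
      then (\<Sum>j | weakF f j w. ?x $ f $ j) = real (q f)
      else (\<Sum>i | weakW w (Some i) (Some f). ?x $ i $ w) = 1" if a: "(f, w) \<in> acceptable" for f w
  proof (cases "prefW w (Some f) (partner \<mu> w)")
    case True
    have "?M f \<inter> {j. weakF f j w} = ?M f"
      using shift_full(2)[OF assms a True] by blast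
    with True show ?thesis
      unfolding F using shift_full(1)[OF assms a True] by simp
  next
    case False
    then have "weakW w (partner ?M w) (Some f)"
      using weakW_shift[OF assms, of w] weakW_trans not_weakW by blast
    moreover have "partner ?M w \<noteq> None"
    proof
      assume "partner ?M w = None"
      with calculation have "weakW w None (Some f)" by simp
      with a show False
        using prefW_asym unfolding acceptable_def weakW_def by auto
    qed
    ultimately show ?thesis
      using False unfolding W by auto
  qed
  ultimately show ?thesis
    unfolding tight_face_def by blast
qed

end

subsection \<open>Cycles of the reduced profile\<close>

context market
begin

context
  fixes \<mu>
  assumes stable: "\<mu> \<in> stable_matchings"
begin

lemma firm_list_subset_wanted: "firm_list \<mu> f - \<mu> f \<subseteq> wanted \<mu> f"
proof
  fix w assume "w \<in> firm_list \<mu> f - \<mu> f"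
  then have "prefF f {w} {}" "prefW w (Some f) None" and n: "\<not> prefW w (partner \<mu> w) (Some f)"
    and "w \<notin> \<mu> f"
    unfolding firm_list_def firm_list12_def worker_list12_def by auto
  moreover from this have "prefW w (Some f) (partner \<mu> w)"
    using stableD(3)[OF stable, of w f] not_weakW[of w "Some f" "partner \<mu> w"]
    unfolding weakW_def by auto
  ultimately show "w \<in> wanted \<mu> f"
    unfolding wanted_def acceptable_def by simp
qed

text \<open>Stability of \<open>\<mu>\<close> disposes of the cut-off at the best worker in
  \<open>\<mu> f\<close>. If \<open>w\<close> were cut off at its worker-optimal partner,
  \<open>f\<close> would be full there, hence nonempty by the positive quota, with workers ranked
  above \<open>w\<close>, against \<open>least\<close>.\<close>

lemma wanted_in_firm_list:
  assumes w: "w \<in> wanted \<mu> f"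
    and least: "worker_optimal f \<noteq> {} \<Longrightarrow> weakF f w (least_preferred f (worker_optimal f))"
  shows "w \<in> firm_list \<mu> f - \<mu> f"
proof -
  have a: "(f, w) \<in> acceptable" and p: "prefW w (Some f) (partner \<mu> w)"
    using w unfolding wanted_def by auto
  have 1: "w \<notin> \<mu> f"
    using p stableD(3)[OF stable, of w f] by auto
  have 2: "\<not> prefF f {w} {most_preferred f (\<mu> f)}" if "\<mu> f \<noteq> {}"
    using stable_full(2)[OF stable a p most_preferred(1)[OF that]] prefF_asym by blast
  have 3: "\<not> prefF f {least_preferred f (worker_optimal f)} {w}" if "worker_optimal f \<noteq> {}"
    using least[OF that] not_weakF by blast
  have 4: "\<not> prefW w (Some f) (partner worker_optimal w)"
  proof
    assume o: "prefW w (Some f) (partner worker_optimal w)"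
    note full = stable_full[OF worker_optimal(1)[OF stable] a o]
    then have ne: "worker_optimal f \<noteq> {}"
      using quota_pos[of f] by auto
    then show False
      using full(2)[OF least_preferred(1)[OF ne]] 3 by blast
  qed
  show ?thesis
    using a p 1 2 3 4 prefW_asym
    unfolding firm_list_def firm_list12_def worker_list12_def acceptable_def by auto
qed

text \<open>The cut-off at the worker-optimal matching can only remove the whole list of a firm.\<close>

lemma next_worker_eq:
  assumes "firm_list \<mu> f - \<mu> f \<noteq> {}"
  shows "wanted \<mu> f \<noteq> {}" and "next_worker \<mu> f = best_wanted \<mu> f"
proof -
  from assms obtain v where v: "v \<in> firm_list \<mu> f - \<mu> f" by blast
  with firm_list_subset_wanted have vw: "v \<in> wanted \<mu> f" by blast
  then show ne: "wanted \<mu> f \<noteq> {}" by blast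
  \<comment> \<open>Passing the lower cut-off is inherited upwards: \<open>v\<close> passes it, and
    the best wanted worker is weakly above \<open>v\<close>.\<close>
  have "weakF f v (least_preferred f (worker_optimal f))" if "worker_optimal f \<noteq> {}"
    using v that not_weakF unfolding firm_list_def firm_list12_def by blast
  then have "best_wanted \<mu> f \<in> firm_list \<mu> f - \<mu> f"
    using best_wanted(1,2)[OF ne] weakF_trans[OF best_wanted(3)[OF ne vw]]
    by (intro wanted_in_firm_list) (auto simp: wanted_def)
  then show "next_worker \<mu> f = best_wanted \<mu> f"
    unfolding next_worker_def
    by (intro most_preferred_eq) (use best_wanted(3)[OF ne] firm_list_subset_wanted in auto)
qed

text \<open>
  A worker whom \<open>f\<close> gains in a stable rotation is preferred by \<open>f\<close> to some worker of
  \<open>worker_optimal f\<close>, because \<open>f\<close> has equally many workers in all stable matchings.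
\<close>

lemma rotating_firm_list:
  assumes rot: "rotating \<mu> U" and f: "f \<in> U"
  shows "firm_list \<mu> f - \<mu> f \<noteq> {}"
proof -
  let ?M = "shift \<mu> U" and ?B = "worker_optimal" and ?w = "best_wanted \<mu> f"
  note M = shift_stable[OF stable rot] and B = worker_optimal[OF stable]
  have wM: "?w \<in> ?M f"
    using in_shift_best_wanted[OF stable rot f] by simp
  have ne: "wanted \<mu> f \<noteq> {}"
    using rot f unfolding rotating_def by blast
  have "weakF f ?w (least_preferred f (?B f))" if "?B f \<noteq> {}"
  proof (cases "?w \<in> ?B f")
    case True
    then show ?thesis using least_preferred(2)[OF that] by blast
  next
    case False
    have "card (?B f) = card (?M f)"
      by (rule card_join(1)[OF M B(1)])
    then have "\<not> ?B f \<subseteq> ?M f"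
      using False wM card_subset_eq[of "?M f" "?B f"] by auto
    then obtain j where j: "j \<in> ?B f" "j \<notin> ?M f" by blast
    have jB: "partner ?B j = Some f" and jM: "partner ?M j \<noteq> Some f"
      using j stableD(3)[OF B(1)] stableD(3)[OF M] by blast+
    \<comment> \<open>\<open>j\<close> is at \<open>f\<close> in the worker-optimal matching but not
      in \<open>?M\<close>, so it would rather be at \<open>f\<close>; stability of
      \<open>?M\<close> then ranks \<open>?w\<close> above \<open>j\<close>.\<close>
    then have "prefW j (Some f) (partner ?M j)"
      using B(2)[OF M, of j] unfolding weakW_def by auto
    then have "prefF f {?w} {j}"
      using stable_full(2)[OF M _ _ wM] stableD(2)[OF B(1) j(1)] by blast
    then show ?thesis
      using least_preferred(2)[OF that j(1)] weakF_trans unfolding weakF_def by blast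
  qed
  then have "?w \<in> firm_list \<mu> f - \<mu> f"
    using best_wanted[OF ne] by (intro wanted_in_firm_list) (auto simp: wanted_def)
  then show ?thesis by blast
qed

text \<open>Meaningful where the best wanted worker is employed, as for every firm of a rotating
  set.\<close>

definition succ_firm :: "'f \<Rightarrow> 'f" where
  "succ_firm f = the (partner \<mu> (best_wanted \<mu> f))"

lemma rotating_succ_firm:
  assumes "rotating \<mu> U" "f \<in> U"
  shows "partner \<mu> (best_wanted \<mu> f) = Some (succ_firm f)" "succ_firm f \<in> U"
proof -
  have "partner \<mu> (best_wanted \<mu> f) \<in> Some ` U"
    using assms unfolding rotating_def by blast
  then show "partner \<mu> (best_wanted \<mu> f) = Some (succ_firm f)" "succ_firm f \<in> U"
    unfolding succ_firm_def by auto
qed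

lemma cycleE:
  assumes "\<sigma> \<in> cycles \<mu>"
  obtains es where "\<sigma> = set es" "es \<noteq> []"
    "\<And>d. d < length es \<Longrightarrow> firm_list \<mu> (es ! d) - \<mu> (es ! d) \<noteq> {}"
    "\<And>d. d < length es \<Longrightarrow> partner \<mu> (best_wanted \<mu> (es ! d)) = Some (es ! (Suc d mod length es))"
proof -
  from assms obtain es where es: "\<sigma> = set es" "es \<noteq> []"
    "\<And>d. d < length es \<Longrightarrow> firm_list \<mu> (es ! d) - \<mu> (es ! d) \<noteq> {}"
    "\<And>d. d < length es \<Longrightarrow> next_worker \<mu> (es ! d) \<in> \<mu> (es ! (Suc d mod length es))"
    unfolding cycles_def by blast
  from es(4) have "partner \<mu> (best_wanted \<mu> (es ! d)) = Some (es ! (Suc d mod length es))"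
    if "d < length es" for d
    using next_worker_eq(2)[OF es(3)] that stableD(3)[OF stable] by metis
  with es(1-3) show thesis by (rule that)
qed

lemma cycle_next_worker:
  assumes "\<sigma> \<in> cycles \<mu>" "f \<in> \<sigma>"
  shows "next_worker \<mu> f = best_wanted \<mu> f"
  using assms next_worker_eq(2) by (metis cycleE in_set_conv_nth)

lemma cycle_rotating:
  assumes "\<sigma> \<in> cycles \<mu>"
  shows "rotating \<mu> \<sigma>"
proof -
  from assms obtain es where es: "\<sigma> = set es" "es \<noteq> []"
    "\<And>d. d < length es \<Longrightarrow> firm_list \<mu> (es ! d) - \<mu> (es ! d) \<noteq> {}"
    "\<And>d. d < length es \<Longrightarrow> partner \<mu> (best_wanted \<mu> (es ! d)) = Some (es ! (Suc d mod length es))"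
    by (rule cycleE) blast
  let ?n = "length es"
  have n: "0 < ?n" using es(2) by simp
  have "(\<lambda>f. partner \<mu> (best_wanted \<mu> f)) ` set es = Some ` set es"
  proof (intro equalityI subsetI)
    fix y assume "y \<in> (\<lambda>f. partner \<mu> (best_wanted \<mu> f)) ` set es"
    then obtain d where "d < ?n" "y = Some (es ! (Suc d mod ?n))"
      using es(4) by (metis (no_types, lifting) imageE in_set_conv_nth)
    then show "y \<in> Some ` set es" using n by simp
  next
    fix y assume "y \<in> Some ` set es"
    then obtain k where k: "k < ?n" "y = Some (es ! k)"
      by (auto simp: in_set_conv_nth)
    obtain d where "d < ?n" "k = Suc d mod ?n"
    proof (cases k)
      case 0
      then show thesis using n by (intro that[of "?n - 1"]) auto
    next
      case (Suc d)
      then show thesis using k by (intro that[of d]) auto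
    qed
    then have "es ! d \<in> set es" "y = partner \<mu> (best_wanted \<mu> (es ! d))"
      using es(4) k by auto
    then show "y \<in> (\<lambda>f. partner \<mu> (best_wanted \<mu> f)) ` set es" by blast
  qed
  moreover have "wanted \<mu> f \<noteq> {}" if "f \<in> set es" for f
    using that es(3) next_worker_eq(1) by (metis in_set_conv_nth)
  ultimately show ?thesis
    unfolding rotating_def es(1) by blast
qed

text \<open>Every firm of the list determines the next through \<open>succ_firm\<close>, so a cycle
  is recovered from any of its members; this makes distinct cycles disjoint.\<close>

lemma cycle_eq_orbit:
  assumes "\<sigma> \<in> cycles \<mu>" "f \<in> \<sigma>"
  shows "\<sigma> = range (\<lambda>k. (succ_firm ^^ k) f)"
proof -
  from assms(1) obtain es where es: "\<sigma> = set es" "es \<noteq> []"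
    "\<And>d. d < length es \<Longrightarrow> partner \<mu> (best_wanted \<mu> (es ! d)) = Some (es ! (Suc d mod length es))"
    by (rule cycleE) blast
  let ?n = "length es"
  have n: "0 < ?n" using es(2) by simp
  obtain d where d: "d < ?n" "f = es ! d"
    using assms(2) es(1) by (auto simp: in_set_conv_nth)
  have pow: "(succ_firm ^^ k) f = es ! ((d + k) mod ?n)" for k
  proof (induction k)
    case (Suc k)
    have "(succ_firm ^^ Suc k) f = succ_firm (es ! ((d + k) mod ?n))"
      using Suc by simp
    also have "\<dots> = es ! (Suc ((d + k) mod ?n) mod ?n)"
      using es(3)[of "(d + k) mod ?n"] n unfolding succ_firm_def by simp
    finally show ?case by (simp add: mod_Suc_eq)
  qed (use d in simp)
  show ?thesis
  proof (intro equalityI subsetI)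
    fix g assume "g \<in> \<sigma>"
    then obtain m where m: "m < ?n" "g = es ! m"
      using es(1) by (auto simp: in_set_conv_nth)
    \<comment> \<open>The summand \<open>?n\<close> keeps the subtraction of naturals from being
      truncated when \<open>m < d\<close>.\<close>
    have "(d + (m + ?n - d)) mod ?n = m"
      using m(1) d(1) by simp
    then have "g = (succ_firm ^^ (m + ?n - d)) f"
      using pow m(2) by simp
    then show "g \<in> range (\<lambda>k. (succ_firm ^^ k) f)" by blast
  qed (use pow n es(1) in auto)
qed

lemma cycles_disjoint:
  assumes "\<sigma> \<in> cycles \<mu>" "\<tau> \<in> cycles \<mu>" "f \<in> \<sigma>" "f \<in> \<tau>"
  shows "\<sigma> = \<tau>"
  using cycle_eq_orbit assms by metis

lemma rotating_cycle:
  assumes rot: "rotating \<mu> U" and f: "f \<in> U"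
  obtains \<sigma> where "\<sigma> \<in> cycles \<mu>" "f \<in> \<sigma>" "\<sigma> \<subseteq> U"
proof -
  \<comment> \<open>The identity outside \<open>U\<close> makes \<open>p\<close> injective on the
    whole finite type, so that \<open>f\<close> returns to itself; its orbit will be the
    cycle.\<close>
  define p where "p e = (if e \<in> U then succ_firm e else e)" for e
  note succ = rotating_succ_firm[OF rot]
  have "inj p"
  proof (rule injI)
    fix a b assume eq: "p a = p b"
    show "a = b"
    proof (cases "a \<in> U \<and> b \<in> U")
      case True
      then show ?thesis
        using eq succ inj_onD[OF rotating_inj(1)[OF rot], of a b] unfolding p_def by simp
    next
      case False
      then show ?thesis
        using eq succ(2) unfolding p_def by (auto split: if_splits)
    qed
  qed
  then have "\<exists>n>0. (p ^^ n) f = f"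
    using funpow_inj_finite[of p f] by (metis finite)
  \<comment> \<open>Minimality of the period yields distinctness: equal iterates
    \<open>i < j\<close> below \<open>n\<close> would make \<open>j - i\<close> a smaller
    period.\<close>
  define n where "n = (LEAST n. 0 < n \<and> (p ^^ n) f = f)"
  have n: "0 < n" "(p ^^ n) f = f"
    using LeastI_ex[OF \<open>\<exists>n>0. (p ^^ n) f = f\<close>] unfolding n_def by auto
  have least: "\<not> (0 < k \<and> (p ^^ k) f = f)" if "k < n" for k
    using that not_less_Least unfolding n_def by blast
  have U: "(p ^^ k) f \<in> U" for k
    using f succ(2) by (induction k) (auto simp: p_def)
  define es where "es = map (\<lambda>k. (p ^^ k) f) [0..<n]"
  have len: "length es = n" and nth: "k < n \<Longrightarrow> es ! k = (p ^^ k) f" for k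
    unfolding es_def by auto
  have "(p ^^ i) f \<noteq> (p ^^ j) f" if "i < j" "j < n" for i j
  proof
    assume "(p ^^ i) f = (p ^^ j) f"
    also have "\<dots> = (p ^^ i) ((p ^^ (j - i)) f)"
      using that(1) by (metis comp_apply funpow_add le_add_diff_inverse less_imp_le)
    finally have "(p ^^ (j - i)) f = f"
      using inj_fn[OF \<open>inj p\<close>, of i] by (metis injD)
    moreover have "0 < j - i" "j - i < n" using that by auto
    ultimately show False using least by blast
  qed
  then have "distinct es"
    unfolding distinct_conv_nth len using nth by (metis linorder_neqE_nat)
  moreover have "es \<noteq> []" using n(1) len by auto
  moreover have "firm_list \<mu> (es ! d) - \<mu> (es ! d) \<noteq> {} \<and>
      next_worker \<mu> (es ! d) \<in> \<mu> (es ! (Suc d mod length es))" if "d < length es" for d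
  proof -
    have d: "d < n" using that len by simp
    have eU: "es ! d \<in> U" using U nth[OF d] by simp
    note fl = rotating_firm_list[OF rot eU]
    have "es ! (Suc d mod n) = (p ^^ Suc d) f"
    proof (cases "Suc d < n")
      case False
      with d have "Suc d = n" by simp
      then show ?thesis using nth[OF n(1)] n(2) by simp
    qed (use nth in simp)
    also have "\<dots> = succ_firm (es ! d)"
      using U[of d] nth[OF d] by (simp add: p_def)
    finally have "next_worker \<mu> (es ! d) \<in> \<mu> (es ! (Suc d mod n))"
      using next_worker_eq(2)[OF fl] succ(1)[OF eU] stableD(3)[OF stable] by simp
    with fl len show ?thesis by simp
  qed
  ultimately have "set es \<in> cycles \<mu>"
    unfolding cycles_def by blast
  moreover have "f \<in> set es"
    using nth[OF n(1)] len n(1) by (metis funpow_0 nth_mem)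
  moreover have "set es \<subseteq> U"
    unfolding es_def using U by auto
  ultimately show thesis by (rule that)
qed

lemma rotating_eq_Union_cycles:
  assumes "rotating \<mu> U"
  shows "\<Union>{\<sigma> \<in> cycles \<mu>. \<sigma> \<subseteq> U} = U"
  using rotating_cycle[OF assms] by blast

lemma rotating_Union_cycles: "K \<subseteq> cycles \<mu> \<Longrightarrow> rotating \<mu> (\<Union>K)"
  by (intro rotating_Union cycle_rotating) blast

text \<open>The cyclic matching removes the next worker of the predecessor within one cycle,
  \<open>shift\<close> all best wanted workers of the union. For a firm of the union this is the
  same single worker, since \<open>\<mu> f\<close> contains just one of them.\<close>

lemma multi_cyclic_matching_eq_shift:
  assumes K: "K \<subseteq> cycles \<mu>"
  shows "multi_cyclic_matching \<mu> K = shift \<mu> (\<Union>K)"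
proof
  fix f
  note rot = rotating_Union_cycles[OF K]
  show "multi_cyclic_matching \<mu> K f = shift \<mu> (\<Union>K) f"
  proof (cases "\<exists>\<sigma>\<in>K. f \<in> \<sigma>")
    case False
    then have "f \<notin> \<Union>K" by blast
    with False show ?thesis
      using Int_best_wanted_notin[OF stable rot, of f]
      unfolding multi_cyclic_matching_def shift_def by auto
  next
    case True
    then obtain \<sigma> where s: "\<sigma> \<in> K" "f \<in> \<sigma>" by blast
    then have sc: "\<sigma> \<in> cycles \<mu>" and fU: "f \<in> \<Union>K" using K by auto
    have THE: "(THE \<sigma>. \<sigma> \<in> K \<and> f \<in> \<sigma>) = \<sigma>"
      using s cycles_disjoint[OF sc] K by (intro the_equality) blast+
    note nw = cycle_next_worker[OF sc]
    obtain e where e: "e \<in> \<sigma>" "best_wanted \<mu> e \<in> \<mu> f"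
      using Int_best_wanted_in[OF stable cycle_rotating[OF sc] s(2)] by blast
    obtain e' where e': "\<mu> f \<inter> best_wanted \<mu> ` (\<Union>K) = {best_wanted \<mu> e'}"
      by (rule Int_best_wanted_in[OF stable rot fU]) (rule that)
    have "best_wanted \<mu> e \<in> \<mu> f \<inter> best_wanted \<mu> ` (\<Union>K)" using e s(1) by blast
    with e' have I: "\<mu> f \<inter> best_wanted \<mu> ` (\<Union>K) = {best_wanted \<mu> e}" by simp
    have "x = e" if "x \<in> \<sigma>" "best_wanted \<mu> x \<in> \<mu> f" for x
    proof -
      have "partner \<mu> (best_wanted \<mu> x) = Some f" "partner \<mu> (best_wanted \<mu> e) = Some f"
        using that e stableD(3)[OF stable] by blast+
      then show ?thesis
        using inj_onD[OF rotating_inj(1)[OF cycle_rotating[OF sc]], of x e] that e by simp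
    qed
    then have "cycle_pred \<mu> \<sigma> f = e"
      unfolding cycle_pred_def using e nw[of e] nw by (intro the_equality) metis+
    then have "multi_cyclic_matching \<mu> K f = (\<mu> f - {best_wanted \<mu> e}) \<union> {best_wanted \<mu> f}"
      using True THE s(2) nw[OF e(1)] nw[OF s(2)]
      unfolding multi_cyclic_matching_def cyclic_matching_def by simp
    also have "\<dots> = shift \<mu> (\<Union>K) f"
      using I fU unfolding shift_def by auto
    finally show ?thesis .
  qed
qed

lemma cyclic_family_eq: "cyclic_family \<mu> = {shift \<mu> (\<Union>K) | K. K \<subseteq> cycles \<mu>}"
  unfolding cyclic_family_def using multi_cyclic_matching_eq_shift by metis

lemma hull_cyclic_family_subset: "convex hull (incidence ` cyclic_family \<mu>) \<subseteq> SSF"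
proof -
  have "incidence ` cyclic_family \<mu> \<subseteq> tight_face \<mu>"
    unfolding cyclic_family_eq
    by (auto intro!: incidence_shift_in_tight_face[OF stable rotating_Union_cycles])
  then have "convex hull (incidence ` cyclic_family \<mu>) \<subseteq> tight_face \<mu>"
    by (rule hull_minimal) (rule convex_tight_face)
  then show ?thesis
    using tight_face_subset_SSF by blast
qed

end

end

subsection \<open>Fractional entries\<close>

text \<open>
  Counting: each edge of \<open>E \<inter> P\<close> has a neighbour in \<open>E - P\<close> at its first vertex and each edge of
  \<open>E \<inter> Q\<close> one in \<open>E - Q\<close> at its second, so \<open>|E \<inter> P| \<le> |E - P| \<le> |E \<inter> Q| \<le> |E - Q| \<le> |E \<inter> P|\<close>,
  and equality holds throughout: every vertex that \<open>E\<close> touches lies on one edge of \<open>P\<close> and one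
  edge of \<open>Q\<close>.
\<close>

lemma two_regular_cover:
  fixes E P Q :: "('a \<times> 'b) set"
  assumes fin: "finite E" and cover: "E \<subseteq> P \<union> Q"
    and P: "inj_on fst (E \<inter> P)" "\<And>e. e \<in> E \<inter> P \<Longrightarrow> \<exists>e'\<in>E. e' \<noteq> e \<and> fst e' = fst e"
    and Q: "inj_on snd (E \<inter> Q)" "\<And>e. e \<in> E \<inter> Q \<Longrightarrow> \<exists>e'\<in>E. e' \<noteq> e \<and> snd e' = snd e"
  shows "E \<inter> P \<inter> Q = {}"
    and "inj_on fst (E \<inter> Q)" and "fst ` (E \<inter> P) = fst ` (E \<inter> Q)"
    and "inj_on snd (E \<inter> P)" and "snd ` (E \<inter> P) = snd ` (E \<inter> Q)"
proof -
  have fP: "fst ` (E \<inter> P) \<subseteq> fst ` (E - P)"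
  proof
    fix a assume "a \<in> fst ` (E \<inter> P)"
    then obtain e where e: "e \<in> E \<inter> P" "a = fst e" by blast
    then obtain e' where e': "e' \<in> E" "e' \<noteq> e" "fst e' = fst e" using P(2) by blast
    then have "e' \<notin> P" using inj_onD[OF P(1), of e' e] e by blast
    with e e' show "a \<in> fst ` (E - P)" by (metis DiffI image_eqI)
  qed
  have sQ: "snd ` (E \<inter> Q) \<subseteq> snd ` (E - Q)"
  proof
    fix a assume "a \<in> snd ` (E \<inter> Q)"
    then obtain e where e: "e \<in> E \<inter> Q" "a = snd e" by blast
    then obtain e' where e': "e' \<in> E" "e' \<noteq> e" "snd e' = snd e" using Q(2) by blast
    then have "e' \<notin> Q" using inj_onD[OF Q(1), of e' e] e by blast
    with e e' show "a \<in> snd ` (E - Q)" by (metis DiffI image_eqI)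
  qed
  have sub: "E - P \<subseteq> E \<inter> Q" "E - Q \<subseteq> E \<inter> P"
    using cover by blast+
  have 1: "card (E \<inter> P) \<le> card (fst ` (E - P))"
    using card_mono[OF _ fP] fin by (simp add: card_image[OF P(1)])
  have 2: "card (E \<inter> Q) \<le> card (snd ` (E - Q))"
    using card_mono[OF _ sQ] fin by (simp add: card_image[OF Q(1)])
  have 3: "card (fst ` (E - P)) \<le> card (E - P)" "card (snd ` (E - Q)) \<le> card (E - Q)"
    using fin by (simp_all add: card_image_le)
  have 4: "card (E - P) \<le> card (E \<inter> Q)" "card (E - Q) \<le> card (E \<inter> P)"
    using sub fin by (simp_all add: card_mono)
  have EP: "E - P = E \<inter> Q" and EQ: "E - Q = E \<inter> P"
    using sub 1 2 3 4 fin by (intro card_subset_eq; simp)+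
  then show "E \<inter> P \<inter> Q = {}" by blast
  show "inj_on fst (E \<inter> Q)" "inj_on snd (E \<inter> P)"
    unfolding EP[symmetric] EQ[symmetric] using 1 2 3 4 fin
    by (intro eq_card_imp_inj_on; simp)+
  show "fst ` (E \<inter> P) = fst ` (E \<inter> Q)"
    unfolding EP[symmetric] using fP 1 2 3 4 fin card_image[OF P(1)]
    by (intro card_subset_eq) auto
  show "snd ` (E \<inter> P) = snd ` (E \<inter> Q)"
    unfolding EQ[symmetric] using sQ 1 2 3 4 fin card_image[OF Q(1)]
    by (intro card_subset_eq[symmetric]) auto
qed

text \<open>If all other terms were 0 or 1, \<open>g a\<close> would be a difference of
  integers.\<close>

lemma ex_other_fractional:
  fixes g :: "'a::finite \<Rightarrow> real"
  assumes "\<And>i. 0 \<le> g i" "\<And>i. g i \<le> 1" and "sum g UNIV \<in> \<int>" and a: "0 < g a" "g a < 1"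
  shows "\<exists>b. b \<noteq> a \<and> 0 < g b \<and> g b < 1"
proof (rule ccontr)
  assume none: "\<not> ?thesis"
  have "g b \<in> \<int>" if "b \<noteq> a" for b
  proof -
    have "g b = 0 \<or> g b = 1"
      using none that assms(1,2)[of b] by force
    then show ?thesis by auto
  qed
  then have "sum g (UNIV - {a}) \<in> \<int>"
    by (intro Ints_sum) auto
  then have "sum g UNIV - sum g (UNIV - {a}) \<in> \<int>"
    using assms(3) by (rule Ints_diff[rotated])
  then have "g a \<in> \<int>"
    by (simp add: sum.remove[of UNIV a g])
  then obtain k where "g a = of_int k" by (rule Ints_cases)
  then show False using a by simp
qed

text \<open>The remaining terms are integers, so \<open>g a + g b\<close> is an integer strictly
  between 0 and 2.\<close>

lemma fractional_pair_sum:
  fixes g :: "'a::finite \<Rightarrow> real"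
  assumes "\<And>i. i \<noteq> a \<Longrightarrow> i \<noteq> b \<Longrightarrow> g i = 0 \<or> g i = 1" and "sum g UNIV \<in> \<int>" and "a \<noteq> b"
    and a: "0 < g a" "g a < 1" and b: "0 < g b" "g b < 1"
  shows "g a + g b = 1"
proof -
  have "g i \<in> \<int>" if "i \<in> UNIV - {a} - {b}" for i
    using assms(1)[of i] that by auto
  then have "sum g (UNIV - {a} - {b}) \<in> \<int>"
    by (intro Ints_sum) auto
  moreover have "sum g UNIV = g a + g b + sum g (UNIV - {a} - {b})"
    using assms(3) by (simp add: sum.remove[of UNIV a g] sum.remove[of "UNIV - {a}" b g])
  ultimately have "g a + g b \<in> \<int>"
    using assms(2) by (metis Ints_diff add_diff_cancel_right')
  then obtain k where k: "g a + g b = of_int k" by (rule Ints_cases)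
  then have "0 < (of_int k :: real)" "(of_int k :: real) < 2"
    using a b by linarith+
  then have "k = 1" by simp
  with k show ?thesis by simp
qed

text \<open>Induction on the edge directions: with weights \<open>1 - t s\<close> and
  \<open>t s\<close> the point lies between its projections to two opposite faces. The base point
  \<open>p\<close> stays arbitrary because the second face starts at \<open>p + v s\<close>.\<close>

lemma cube_in_convex_hull:
  fixes v :: "'i \<Rightarrow> 'v::real_vector"
  assumes "finite S" and "\<And>s. s \<in> S \<Longrightarrow> 0 \<le> t s \<and> t s \<le> 1"
  shows "p + (\<Sum>s\<in>S. t s *\<^sub>R v s) \<in> convex hull {p + (\<Sum>s\<in>K. v s) | K. K \<subseteq> S}"
  using assms
proof (induction S arbitrary: p rule: finite_induct)
  case empty
  then show ?case by (simp add: hull_inc)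
next
  case (insert s S)
  let ?H = "convex hull {p + (\<Sum>s\<in>K. v s) | K. K \<subseteq> insert s S}"
  let ?r = "\<Sum>s\<in>S. t s *\<^sub>R v s"
  have "{p + (\<Sum>s\<in>K. v s) | K. K \<subseteq> S} \<subseteq> {p + (\<Sum>s\<in>K. v s) | K. K \<subseteq> insert s S}"
    by blast
  then have 1: "p + ?r \<in> ?H"
    using insert.IH[of p] insert.prems hull_mono by blast
  have "{(p + v s) + (\<Sum>s\<in>K. v s) | K. K \<subseteq> S} \<subseteq> {p + (\<Sum>s\<in>K. v s) | K. K \<subseteq> insert s S}"
  proof clarify
    fix K assume K: "K \<subseteq> S"
    then have "p + v s + sum v K = p + sum v (insert s K)"
      using insert.hyps finite_subset[OF K] by (subst sum.insert) (auto simp: add.assoc)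
    with K show "\<exists>K'. p + v s + sum v K = p + sum v K' \<and> K' \<subseteq> insert s S"
      by (intro exI[of _ "insert s K"]) auto
  qed
  then have 2: "(p + v s) + ?r \<in> ?H"
    using insert.IH[of "p + v s"] insert.prems hull_mono by blast
  have "(1 - t s) *\<^sub>R (p + ?r) + t s *\<^sub>R ((p + v s) + ?r) \<in> ?H"
    using 1 2 insert.prems by (intro convexD[OF convex_convex_hull]) auto
  also have "(1 - t s) *\<^sub>R (p + ?r) + t s *\<^sub>R ((p + v s) + ?r) = p + (\<Sum>s\<in>insert s S. t s *\<^sub>R v s)"
    using insert.hyps by (simp add: algebra_simps)
  finally show ?case .
qed

section \<open>The support of a strongly stable fractional matching\<close>

context market
begin

context
  fixes x :: "real ^ 'w ^ 'f"
  assumes ssf: "x \<in> SSF"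
begin

text \<open>Being last is expressed by the vanishing factor of the complementarity condition;
  \<open>row_tight\<close> and \<open>column_tight\<close> translate this into the order on the
  support.\<close>

definition firm_last :: "('f \<times> 'w) set" where
  "firm_last = {(f, w). 0 < x $ f $ w \<and> (\<Sum>j | weakF f j w. x $ f $ j) = real (q f)}"

definition worker_last :: "('f \<times> 'w) set" where
  "worker_last = {(f, w). 0 < x $ f $ w \<and> (\<Sum>i | weakW w (Some i) (Some f). x $ i $ w) = 1}"

definition fractional :: "('f \<times> 'w) set" where
  "fractional = {(f, w). 0 < x $ f $ w \<and> x $ f $ w < 1}"

definition last_matching :: "'f \<Rightarrow> 'w set" where
  "last_matching f = {w. (f, w) \<in> worker_last}"

lemma entry_bounds: "0 \<le> x $ f $ w" "x $ f $ w \<le> 1"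
proof -
  show nn: "0 \<le> x $ f $ w" for f w
    using ssf unfolding SSF_def CP_def by blast
  have "x $ f $ w \<le> (\<Sum>i\<in>UNIV. x $ i $ w)"
    by (rule member_le_sum) (use nn in auto)
  also have "\<dots> \<le> 1"
    using ssf unfolding SSF_def CP_def by blast
  finally show "x $ f $ w \<le> 1" .
qed

lemma row_le: "(\<Sum>j\<in>J. x $ f $ j) \<le> real (q f)"
proof -
  have "(\<Sum>j\<in>J. x $ f $ j) \<le> (\<Sum>j\<in>UNIV. x $ f $ j)"
    by (rule sum_mono2) (use entry_bounds in auto)
  also have "\<dots> \<le> real (q f)"
    using ssf unfolding SSF_def CP_def by blast
  finally show ?thesis .
qed

lemma column_le: "(\<Sum>i\<in>I. x $ i $ w) \<le> 1"
proof -
  have "(\<Sum>i\<in>I. x $ i $ w) \<le> (\<Sum>i\<in>UNIV. x $ i $ w)"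
    by (rule sum_mono2) (use entry_bounds in auto)
  also have "\<dots> \<le> 1"
    using ssf unfolding SSF_def CP_def by blast
  finally show ?thesis .
qed

lemma support_acceptable: "0 < x $ f $ w \<Longrightarrow> (f, w) \<in> acceptable"
  using ssf unfolding SSF_def CP_def by fastforce

lemma complementarity:
  assumes "(f, w) \<in> acceptable"
  shows "(\<Sum>j | weakF f j w. x $ f $ j) = real (q f) \<or>
    (\<Sum>i | weakW w (Some i) (Some f). x $ i $ w) = 1"
  using ssf assms unfolding SSF_def by force

lemma row_tight:
  assumes "(\<Sum>j | weakF f j w. x $ f $ j) = real (q f)"
  shows "(\<Sum>j\<in>UNIV. x $ f $ j) = real (q f)" and "0 < x $ f $ j \<Longrightarrow> weakF f j w"
proof -
  show "(\<Sum>j\<in>UNIV. x $ f $ j) = real (q f)"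
  proof (rule antisym[OF row_le])
    show "real (q f) \<le> (\<Sum>j\<in>UNIV. x $ f $ j)"
      unfolding assms[symmetric] by (rule sum_mono2) (use entry_bounds in auto)
  qed
  assume j: "0 < x $ f $ j"
  show "weakF f j w"
  proof (rule ccontr)
    assume "\<not> weakF f j w"
    then have "(\<Sum>j\<in>insert j {j. weakF f j w}. x $ f $ j) = x $ f $ j + real (q f)"
      using assms by simp
    with row_le[of f "insert j {j. weakF f j w}"] j show False by simp
  qed
qed

lemma column_tight:
  assumes "(\<Sum>i | weakW w (Some i) (Some f). x $ i $ w) = 1"
  shows "(\<Sum>i\<in>UNIV. x $ i $ w) = 1" and "0 < x $ i $ w \<Longrightarrow> weakW w (Some i) (Some f)"
proof -
  show "(\<Sum>i\<in>UNIV. x $ i $ w) = 1"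
  proof (rule antisym[OF column_le])
    show "1 \<le> (\<Sum>i\<in>UNIV. x $ i $ w)"
      unfolding assms[symmetric] by (rule sum_mono2) (use entry_bounds in auto)
  qed
  assume i: "0 < x $ i $ w"
  show "weakW w (Some i) (Some f)"
  proof (rule ccontr)
    assume "\<not> weakW w (Some i) (Some f)"
    then have "(\<Sum>i\<in>insert i {i. weakW w (Some i) (Some f)}. x $ i $ w) = x $ i $ w + 1"
      using assms by simp
    with column_le[of w "insert i {i. weakW w (Some i) (Some f)}"] i show False by simp
  qed
qed

lemma firm_last_unique: "(f, w) \<in> firm_last \<Longrightarrow> (f, w') \<in> firm_last \<Longrightarrow> w = w'"
  unfolding firm_last_def using row_tight(2) weakF_antisym by blast

lemma worker_last_unique:
  assumes "(f, w) \<in> worker_last" "(f', w) \<in> worker_last"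
  shows "f = f'"
proof -
  from assms have "0 < x $ f $ w" "0 < x $ f' $ w"
    and c: "(\<Sum>i | weakW w (Some i) (Some f). x $ i $ w) = 1"
    and c': "(\<Sum>i | weakW w (Some i) (Some f'). x $ i $ w) = 1"
    unfolding worker_last_def by simp_all
  then have "weakW w (Some f) (Some f')" "weakW w (Some f') (Some f)"
    using column_tight(2)[OF c] column_tight(2)[OF c'] by blast+
  then show ?thesis using weakW_antisym by blast
qed

text \<open>An entry 1 uses up the capacity of a worker but in general not that of a firm. This
  asymmetry is why the matching is read off the column-last entries.\<close>

lemma entry_one_worker_last:
  assumes "x $ f $ w = 1"
  shows "(f, w) \<in> worker_last"
proof -
  have "x $ f $ w \<le> (\<Sum>i | weakW w (Some i) (Some f). x $ i $ w)"
    by (rule member_le_sum) (use entry_bounds in auto)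
  then have "(\<Sum>i | weakW w (Some i) (Some f). x $ i $ w) = 1"
    using assms column_le[of w "{i. weakW w (Some i) (Some f)}"] by simp
  then show ?thesis
    using assms unfolding worker_last_def by simp
qed

lemma not_fractional:
  assumes "(f, w) \<notin> fractional"
  shows "x $ f $ w = of_bool ((f, w) \<in> worker_last)"
proof -
  have "x $ f $ w = 0 \<or> x $ f $ w = 1"
    using assms entry_bounds[of f w] unfolding fractional_def by force
  then show ?thesis
    using entry_one_worker_last unfolding worker_last_def by auto
qed

text \<open>An instance of \<open>two_regular_cover\<close>: last entries are unique, which gives
  the injectivity, and the integral sums of tight rows and columns supply the second fractional
  entry.\<close>

lemma fractional_structure:
  shows "fractional \<subseteq> firm_last \<union> worker_last"
    and "fractional \<inter> firm_last \<inter> worker_last = {}"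
    and "inj_on fst (fractional \<inter> worker_last)"
    and "fst ` (fractional \<inter> firm_last) = fst ` (fractional \<inter> worker_last)"
    and "inj_on snd (fractional \<inter> firm_last)"
    and "snd ` (fractional \<inter> firm_last) = snd ` (fractional \<inter> worker_last)"
proof -
  have fin: "finite fractional" by simp
  show cover: "fractional \<subseteq> firm_last \<union> worker_last"
    unfolding fractional_def firm_last_def worker_last_def
    using complementarity support_acceptable by blast
  have P: "inj_on fst (fractional \<inter> firm_last)"
    by (rule inj_onI) (use firm_last_unique in auto)
  have Q: "inj_on snd (fractional \<inter> worker_last)"
    by (rule inj_onI) (use worker_last_unique in auto)
  have P': "\<exists>e'\<in>fractional. e' \<noteq> e \<and> fst e' = fst e" if eP: "e \<in> fractional \<inter> firm_last" for e
  proof -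
    obtain f w where e: "e = (f, w)" by (cases e)
    have "(\<Sum>j\<in>UNIV. x $ f $ j) \<in> \<int>"
      using that row_tight(1) unfolding e firm_last_def by auto
    then obtain j where "j \<noteq> w" "0 < x $ f $ j" "x $ f $ j < 1"
      using ex_other_fractional[of "\<lambda>j. x $ f $ j" w, OF entry_bounds] eP
      unfolding e fractional_def by blast
    then show ?thesis
      unfolding e fractional_def by (intro bexI[of _ "(f, j)"]) auto
  qed
  have Q': "\<exists>e'\<in>fractional. e' \<noteq> e \<and> snd e' = snd e" if eQ: "e \<in> fractional \<inter> worker_last" for e
  proof -
    obtain f w where e: "e = (f, w)" by (cases e)
    have "(\<Sum>i\<in>UNIV. x $ i $ w) \<in> \<int>"
      using that column_tight(1) unfolding e worker_last_def by auto
    then obtain i where "i \<noteq> f" "0 < x $ i $ w" "x $ i $ w < 1"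
      using ex_other_fractional[of "\<lambda>i. x $ i $ w" f, OF entry_bounds] eQ
      unfolding e fractional_def by blast
    then show ?thesis
      unfolding e fractional_def by (intro bexI[of _ "(i, w)"]) auto
  qed
  note two_regular_cover[OF fin cover P P' Q Q']
  then show "fractional \<inter> firm_last \<inter> worker_last = {}"
    "inj_on fst (fractional \<inter> worker_last)"
    "fst ` (fractional \<inter> firm_last) = fst ` (fractional \<inter> worker_last)"
    "inj_on snd (fractional \<inter> firm_last)"
    "snd ` (fractional \<inter> firm_last) = snd ` (fractional \<inter> worker_last)"
    by blast+
qed

lemma firm_other_edge:
  assumes "(f, w) \<in> fractional \<inter> firm_last"
  obtains w' where "(f, w') \<in> fractional \<inter> worker_last"
proof -
  have "f \<in> fst ` (fractional \<inter> firm_last)"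
    using assms by (rule rev_image_eqI) simp
  then obtain w' where "(f, w') \<in> fractional \<inter> worker_last"
    unfolding fractional_structure(4) by fastforce
  then show thesis by (rule that)
qed

lemma worker_other_edge:
  assumes "(f, w) \<in> fractional \<inter> firm_last"
  obtains g where "(g, w) \<in> fractional \<inter> worker_last"
proof -
  have "w \<in> snd ` (fractional \<inter> firm_last)"
    using assms by (rule rev_image_eqI) simp
  then obtain g where "(g, w) \<in> fractional \<inter> worker_last"
    unfolding fractional_structure(6) by fastforce
  then show thesis by (rule that)
qed

text \<open>\<open>fst\<close> is injective on the fractional entries of either kind, so row
  \<open>f\<close> has one of each and is integral elsewhere.\<close>

lemma firm_pair:
  assumes P: "(f, w) \<in> fractional \<inter> firm_last" and Q: "(f, w') \<in> fractional \<inter> worker_last"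
  shows "x $ f $ w + x $ f $ w' = 1" and "w \<noteq> w'"
    and "(f, j) \<in> fractional \<Longrightarrow> j = w \<or> j = w'"
proof -
  show ne: "w \<noteq> w'"
    using fractional_structure(2) P Q by blast
  show only: "j = w \<or> j = w'" if "(f, j) \<in> fractional" for j
    using that fractional_structure(1) firm_last_unique[of f j w] P
      inj_onD[OF fractional_structure(3), of "(f, j)" "(f, w')"] Q by auto
  have "(\<Sum>j\<in>UNIV. x $ f $ j) \<in> \<int>"
    using P row_tight(1) unfolding firm_last_def by auto
  then show "x $ f $ w + x $ f $ w' = 1"
  proof (rule fractional_pair_sum[rotated, OF _ ne])
    show "x $ f $ j = 0 \<or> x $ f $ j = 1" if "j \<noteq> w" "j \<noteq> w'" for j
      using only that not_fractional[of f j] by (cases "(f, j) \<in> worker_last") auto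
  qed (use P Q in \<open>auto simp: fractional_def\<close>)
qed

lemma worker_pair:
  assumes P: "(f, w) \<in> fractional \<inter> firm_last" and Q: "(g, w) \<in> fractional \<inter> worker_last"
  shows "x $ f $ w + x $ g $ w = 1" and "f \<noteq> g"
    and "(i, w) \<in> fractional \<Longrightarrow> i = f \<or> i = g"
proof -
  show ne: "f \<noteq> g"
    using fractional_structure(2) P Q by blast
  show only: "i = f \<or> i = g" if "(i, w) \<in> fractional" for i
    using that fractional_structure(1) worker_last_unique[of i w g] Q
      inj_onD[OF fractional_structure(5), of "(i, w)" "(f, w)"] P by auto
  have "(\<Sum>i\<in>UNIV. x $ i $ w) \<in> \<int>"
    using Q column_tight(1) unfolding worker_last_def by auto
  then show "x $ f $ w + x $ g $ w = 1"
  proof (rule fractional_pair_sum[rotated, OF _ ne])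
    show "x $ i $ w = 0 \<or> x $ i $ w = 1" if "i \<noteq> f" "i \<noteq> g" for i
      using only that not_fractional[of i w] by (cases "(i, w) \<in> worker_last") auto
  qed (use P Q in \<open>auto simp: fractional_def\<close>)
qed

text \<open>Passing from \<open>x\<close> to the matching changes a row only at its fractional pair,
  where values with sum 1 become 0 and 1.\<close>

lemma card_last_matching: "real (card (last_matching f)) = (\<Sum>j\<in>UNIV. x $ f $ j)"
proof -
  have card: "real (card (last_matching f)) = (\<Sum>j\<in>UNIV. of_bool ((f, j) \<in> worker_last))"
    unfolding last_matching_def by (simp add: sum_of_bool_eq)
  show ?thesis
  proof (cases "\<exists>w. (f, w) \<in> fractional \<inter> firm_last")
    case True
    then obtain w where P: "(f, w) \<in> fractional \<inter> firm_last" by blast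
    obtain w' where Q: "(f, w') \<in> fractional \<inter> worker_last"
      using firm_other_edge[OF P] .
    let ?d = "\<lambda>j. x $ f $ j - of_bool ((f, j) \<in> worker_last)"
    have "?d j = 0" if "j \<noteq> w" "j \<noteq> w'" for j
      using that firm_pair(3)[OF P Q, of j] not_fractional[of f j] by fastforce
    then have "(\<Sum>j\<in>UNIV. ?d j) = (\<Sum>j\<in>{w, w'}. ?d j)"
      by (intro sum.mono_neutral_right) auto
    also have "\<dots> = ?d w + ?d w'"
      using firm_pair(2)[OF P Q] by simp
    also have "\<dots> = 0"
      using firm_pair(1)[OF P Q] P Q fractional_structure(2) by auto
    finally show ?thesis
      unfolding card by (simp add: sum_subtractf)
  next
    case False
    then have "f \<notin> fst ` (fractional \<inter> firm_last)" by force
    then have "(f, j) \<notin> fractional \<inter> firm_last" "(f, j) \<notin> fractional \<inter> worker_last" for j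
      using fractional_structure(4) by (metis fst_conv imageI)+
    then have "(f, j) \<notin> fractional" for j
      using fractional_structure(1) by blast
    then show ?thesis
      unfolding card using not_fractional by simp
  qed
qed

lemma matching_last_matching: "matching last_matching"
  unfolding matching_def
proof (intro conjI allI impI)
  show "card (last_matching f) \<le> q f" for f
    using card_last_matching[of f] row_le[where J = UNIV] by (metis of_nat_le_iff)
  show "last_matching f \<inter> last_matching g = {}" if "f \<noteq> g" for f g
    using that worker_last_unique unfolding last_matching_def by blast
qed

lemma partner_last_matching: "partner last_matching w = Some f \<longleftrightarrow> (f, w) \<in> worker_last"
  using partner_eq_Some[OF matching_last_matching] unfolding last_matching_def by simp

lemma support_worker_last:
  assumes "0 < x $ f $ w"
  obtains g where "(g, w) \<in> worker_last"
proof (cases "(f, w) \<in> fractional")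
  case True
  then have "(f, w) \<in> fractional \<inter> firm_last \<or> (f, w) \<in> worker_last"
    using fractional_structure(1) by blast
  then show thesis
  proof
    assume "(f, w) \<in> fractional \<inter> firm_last"
    then obtain g where "(g, w) \<in> fractional \<inter> worker_last"
      by (rule worker_other_edge)
    then show thesis using that by blast
  qed (rule that)
next
  case False
  then show thesis
    using assms not_fractional[of f w] that by (auto simp: of_bool_def split: if_splits)
qed

text \<open>Otherwise complementarity fills the column of \<open>w\<close> down to \<open>f\<close>.
  Its support then has a worker-last entry, the partner of \<open>w\<close>, at or above
  \<open>f\<close>, whereas \<open>w\<close> prefers \<open>f\<close> to its partner.\<close>

lemma wanted_row_tight:
  assumes "w \<in> wanted last_matching f"
  shows "(\<Sum>j | weakF f j w. x $ f $ j) = real (q f)"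
proof (rule ccontr)
  assume "\<not> ?thesis"
  then have c: "(\<Sum>i | weakW w (Some i) (Some f). x $ i $ w) = 1"
    using complementarity assms unfolding wanted_def by blast
  have p: "prefW w (Some f) (partner last_matching w)"
    using assms unfolding wanted_def by blast
  have "\<exists>i. 0 < x $ i $ w"
  proof (rule ccontr)
    assume "\<not> ?thesis"
    then have "x $ i $ w = 0" for i
      using entry_bounds(1)[of i w] by (meson antisym not_less)
    with c show False by simp
  qed
  then obtain f' where "0 < x $ f' $ w" ..
  then obtain g where g: "(g, w) \<in> worker_last"
    by (rule support_worker_last)
  then have "weakW w (Some g) (Some f)"
    using column_tight(2)[OF c] unfolding worker_last_def by blast
  moreover have "partner last_matching w = Some g"
    using g partner_last_matching by simp
  ultimately show False
    using p not_weakW by metis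
qed

lemma last_matching_stable: "last_matching \<in> stable_matchings"
proof (rule stableI[OF matching_last_matching])
  have supp: "0 < x $ f $ w" if "w \<in> last_matching f" for f w
    using that unfolding last_matching_def worker_last_def by blast
  show "(f, w) \<in> acceptable" if "w \<in> last_matching f" for f w
    using supp[OF that] by (rule support_acceptable)
  fix f w assume "(f, w) \<in> acceptable" "prefW w (Some f) (partner last_matching w)"
  then have t: "(\<Sum>j | weakF f j w. x $ f $ j) = real (q f)"
    by (intro wanted_row_tight) (simp add: wanted_def)
  have "real (card (last_matching f)) = real (q f)"
    using card_last_matching[of f] row_tight(1)[OF t] by simp
  then show "card (last_matching f) = q f \<and> (\<forall>j\<in>last_matching f. weakF f j w)"
    using row_tight(2)[OF t] supp by auto
qed

text \<open>The partner of \<open>w\<close> is its worker-last firm, which \<open>w\<close> ranks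
  below the other firms of its support, hence below \<open>f\<close>. For any other wanted worker,
  \<open>wanted_row_tight\<close> puts the support of the row, \<open>w\<close> included, weakly
  above it.\<close>

lemma firm_last_wanted:
  assumes P: "(f, w) \<in> fractional \<inter> firm_last"
  shows "w \<in> wanted last_matching f" and "best_wanted last_matching f = w"
proof -
  have pos: "0 < x $ f $ w"
    using P unfolding fractional_def by blast
  obtain g where Q: "(g, w) \<in> fractional \<inter> worker_last"
    using worker_other_edge[OF P] .
  have "weakW w (Some f) (Some g)"
    using Q pos column_tight(2) unfolding worker_last_def by blast
  then have "prefW w (Some f) (partner last_matching w)"
    using worker_pair(2)[OF P Q] Q partner_last_matching[of w g] unfolding weakW_def by auto
  then show w: "w \<in> wanted last_matching f"
    using support_acceptable[OF pos] unfolding wanted_def by blast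
  show "best_wanted last_matching f = w"
    unfolding best_wanted_def
    by (rule most_preferred_eq[OF w]) (rule row_tight(2)[OF wanted_row_tight pos])
qed

definition fractional_firms :: "'f set" where
  "fractional_firms = fst ` (fractional \<inter> firm_last)"

lemma fractional_firms_edge:
  assumes "f \<in> fractional_firms"
  shows "(f, best_wanted last_matching f) \<in> fractional \<inter> firm_last"
proof -
  obtain w where w: "(f, w) \<in> fractional \<inter> firm_last"
    using assms unfolding fractional_firms_def by force
  with firm_last_wanted(2)[OF w] show ?thesis by simp
qed

text \<open>From a firm, its firm-last edge leads to a worker, whose worker-last edge leads to a
  firm. Both kinds of edges touch the same firms and the same workers, so this map stays in the set
  and is onto.\<close>

lemma rotating_fractional_firms: "rotating last_matching fractional_firms"
  unfolding rotating_def
proof (intro conjI ballI)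
  let ?p = "\<lambda>f. partner last_matching (best_wanted last_matching f)"
  show "wanted last_matching f \<noteq> {}" if "f \<in> fractional_firms" for f
    using firm_last_wanted(1)[OF fractional_firms_edge[OF that]] by blast
  show "?p ` fractional_firms = Some ` fractional_firms"
  proof (intro equalityI subsetI)
    fix y assume "y \<in> ?p ` fractional_firms"
    then obtain f where f: "f \<in> fractional_firms" "y = ?p f" by blast
    obtain g where g: "(g, best_wanted last_matching f) \<in> fractional \<inter> worker_last"
      using worker_other_edge[OF fractional_firms_edge[OF f(1)]] .
    then have "y = Some g" using f(2) partner_last_matching by simp
    moreover have "g \<in> fractional_firms"
      unfolding fractional_firms_def fractional_structure(4) using g by force
    ultimately show "y \<in> Some ` fractional_firms" by blast
  next
    fix y assume "y \<in> Some ` fractional_firms"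
    then obtain g where g: "g \<in> fractional_firms" "y = Some g" by blast
    then obtain w where w: "(g, w) \<in> fractional \<inter> worker_last"
      unfolding fractional_firms_def fractional_structure(4) by force
    then have "w \<in> snd ` (fractional \<inter> firm_last)"
      unfolding fractional_structure(6) by force
    then obtain f where f: "(f, w) \<in> fractional \<inter> firm_last" by force
    have "?p f = y"
      using firm_last_wanted(2)[OF f] w g(2) partner_last_matching by simp
    moreover have "f \<in> fractional_firms"
      unfolding fractional_firms_def using f by force
    ultimately show "y \<in> ?p ` fractional_firms" by blast
  qed
qed

end

end

subsection \<open>Decomposition of a strongly stable fractional matching\<close>

context market
begin

text \<open>
  The effect of one firm \<open>e\<close> of a rotation on the incidence vector: \<open>e\<close> gains
  \<open>best_wanted \<mu> e\<close> and the employer of that worker under \<open>\<mu>\<close> loses it.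
\<close>

definition transfer :: "('f \<Rightarrow> 'w set) \<Rightarrow> 'f \<Rightarrow> real ^ 'w ^ 'f" where
  "transfer \<mu> e = (\<chi> f w. if w = best_wanted \<mu> e then of_bool (f = e) - of_bool (w \<in> \<mu> f) else 0)"

text \<open>Distinct firms of \<open>U\<close> have distinct best wanted workers, so their transfers
  live in different columns.\<close>

lemma sum_transfer:
  assumes rot: "rotating \<mu> U"
  shows "w \<notin> best_wanted \<mu> ` U \<Longrightarrow> (\<Sum>e\<in>U. t e *\<^sub>R transfer \<mu> e) $ f $ w = 0"
    and "e \<in> U \<Longrightarrow> (\<Sum>e\<in>U. t e *\<^sub>R transfer \<mu> e) $ f $ best_wanted \<mu> e =
      t e * (of_bool (f = e) - of_bool (best_wanted \<mu> e \<in> \<mu> f))"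
proof -
  show "(\<Sum>e\<in>U. t e *\<^sub>R transfer \<mu> e) $ f $ w = 0" if "w \<notin> best_wanted \<mu> ` U"
    unfolding sum_component using that by (intro sum.neutral) (auto simp: transfer_def)
  assume e: "e \<in> U"
  have "transfer \<mu> e' $ f $ best_wanted \<mu> e = 0" if "e' \<in> U - {e}" for e'
    using inj_onD[OF rotating_inj(2)[OF rot], of e e'] that e unfolding transfer_def by auto
  then have "(\<Sum>e'\<in>U. t e' * transfer \<mu> e' $ f $ best_wanted \<mu> e) =
      t e * transfer \<mu> e $ f $ best_wanted \<mu> e"
    using e by (simp add: sum.remove[of U e])
  then show "(\<Sum>e\<in>U. t e *\<^sub>R transfer \<mu> e) $ f $ best_wanted \<mu> e =
      t e * (of_bool (f = e) - of_bool (best_wanted \<mu> e \<in> \<mu> f))"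
    by (simp add: transfer_def)
qed

lemma incidence_shift:
  assumes stable: "\<mu> \<in> stable_matchings" and rot: "rotating \<mu> U"
  shows "incidence (shift \<mu> U) = incidence \<mu> + (\<Sum>e\<in>U. transfer \<mu> e)"
proof -
  have "incidence (shift \<mu> U) $ f $ w = incidence \<mu> $ f $ w + (\<Sum>e\<in>U. 1 *\<^sub>R transfer \<mu> e) $ f $ w"
    for f w
  proof (cases "w \<in> best_wanted \<mu> ` U")
    case True
    then obtain e where e: "e \<in> U" "w = best_wanted \<mu> e" by blast
    show ?thesis
      unfolding e(2) sum_transfer(2)[OF rot e(1)] incidence_nth[OF stableD(1)[OF stable]]
        incidence_nth[OF matching_shift[OF assms]] in_shift_best_wanted[OF assms e(1)]
      by simp
  next
    case False
    show ?thesis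
      unfolding sum_transfer(1)[OF rot False] incidence_nth[OF stableD(1)[OF stable]]
        incidence_nth[OF matching_shift[OF assms]] in_shift_other[OF assms False]
      by simp
  qed
  then show ?thesis
    by (simp add: vec_eq_iff)
qed

context
  fixes x :: "real ^ 'w ^ 'f"
  assumes ssf: "x \<in> SSF"
begin

private abbreviation "\<mu> \<equiv> last_matching x"
private abbreviation "A \<equiv> fractional_firms x"

definition weight :: "'f \<Rightarrow> real" where
  "weight f = x $ f $ best_wanted \<mu> f"

text \<open>The column of \<open>best_wanted \<mu> e\<close> has two fractional entries,
  \<open>t\<close> at \<open>e\<close> and \<open>1 - t\<close> at the employer under
  \<open>\<mu>\<close>. All other columns are integral and agree with those of the matching.\<close>

lemma decomposition: "x = incidence \<mu> + (\<Sum>e\<in>A. weight e *\<^sub>R transfer \<mu> e)"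
proof -
  note rot = rotating_fractional_firms[OF ssf]
  have inc: "incidence \<mu> $ f $ w = of_bool ((f, w) \<in> worker_last x)" for f w
    unfolding incidence_nth[OF matching_last_matching[OF ssf]]
    by (simp add: last_matching_def[OF ssf])
  have "x $ f $ w = incidence \<mu> $ f $ w + (\<Sum>e\<in>A. weight e *\<^sub>R transfer \<mu> e) $ f $ w" for f w
  proof (cases "w \<in> best_wanted \<mu> ` A")
    case True
    then obtain e where e: "e \<in> A" "w = best_wanted \<mu> e" by blast
    have P: "(e, w) \<in> fractional x \<inter> firm_last x"
      using fractional_firms_edge[OF ssf e(1)] e(2) by simp
    obtain g where Q: "(g, w) \<in> fractional x \<inter> worker_last x"
      using worker_other_edge[OF ssf P] .
    note pair = worker_pair[OF ssf P Q]
    have wl: "(f, w) \<in> worker_last x \<longleftrightarrow> f = g"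
      using Q worker_last_unique[OF ssf] by blast
    have "(\<Sum>e\<in>A. weight e *\<^sub>R transfer \<mu> e) $ f $ w = x $ e $ w * (of_bool (f = e) - of_bool (f = g))"
      using sum_transfer(2)[OF rot e(1), of weight f] wl
      unfolding e(2)[symmetric] by (simp add: weight_def e(2)[symmetric] last_matching_def[OF ssf])
    moreover have "x $ f $ w = 0" if "f \<noteq> e" "f \<noteq> g"
      using not_fractional[OF ssf, of f w] pair(3) wl that by auto
    ultimately show ?thesis
      using pair(1,2) unfolding inc wl by (cases "f = e"; cases "f = g") auto
  next
    case False
    have "(f, w) \<notin> fractional x"
    proof
      assume fr: "(f, w) \<in> fractional x"
      have "w \<in> snd ` (fractional x \<inter> firm_last x)"
      proof (cases "(f, w) \<in> firm_last x")
        case True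
        with fr show ?thesis by force
      next
        case False
        with fr have "(f, w) \<in> fractional x \<inter> worker_last x"
          using fractional_structure(1)[OF ssf] by blast
        then show ?thesis
          unfolding fractional_structure(6)[OF ssf] by force
      qed
      then obtain e where e: "(e, w) \<in> fractional x \<inter> firm_last x" by force
      then have "e \<in> A"
        unfolding fractional_firms_def[OF ssf] by force
      then show False
        using False firm_last_wanted(2)[OF ssf e] by blast
    qed
    then show ?thesis
      using not_fractional[OF ssf] unfolding sum_transfer(1)[OF rot False] inc by simp
  qed
  then show ?thesis by (simp add: vec_eq_iff)
qed

text \<open>The column of the best wanted worker of \<open>f\<close> and the row of its employer
  \<open>g\<close> each contain a fractional pair of sum 1. The entry of \<open>g\<close> at that
  worker is in both pairs; the other two entries are the two weights.\<close>

lemma weight_succ_firm: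
  assumes f: "f \<in> A"
  shows "weight (succ_firm \<mu> f) = weight f"
proof -
  let ?w = "best_wanted \<mu> f"
  note P = fractional_firms_edge[OF ssf f]
  obtain g where Q: "(g, ?w) \<in> fractional x \<inter> worker_last x"
    using worker_other_edge[OF ssf P] .
  have s: "succ_firm \<mu> f = g"
    using Q partner_last_matching[OF ssf, of ?w g] unfolding succ_firm_def[OF last_matching_stable[OF ssf]]
    by simp
  have "g \<in> A"
    using rotating_succ_firm(2)[OF last_matching_stable[OF ssf] rotating_fractional_firms[OF ssf] f] s
    by simp
  then show ?thesis
    using firm_pair(1)[OF ssf fractional_firms_edge[OF ssf] Q] worker_pair(1)[OF ssf P Q]
    unfolding weight_def s by simp
qed

lemma SSF_in_hull: "x \<in> convex hull (incidence ` cyclic_family \<mu>)"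
proof -
  note st = last_matching_stable[OF ssf] and rot = rotating_fractional_firms[OF ssf]
  define S where "S = {\<sigma> \<in> cycles \<mu>. \<sigma> \<subseteq> A}"
  \<comment> \<open>Any representative will do, as \<open>const\<close> shows. Being an entry of
    \<open>x\<close>, the value lies between 0 and 1 in any case.\<close>
  define \<tau> where "\<tau> \<sigma> = weight (SOME e. e \<in> \<sigma>)" for \<sigma>
  have US: "\<Union>S = A"
    unfolding S_def by (rule rotating_eq_Union_cycles[OF st rot])
  have disj: "\<forall>\<sigma>\<in>S. \<forall>\<sigma>'\<in>S. \<sigma> \<noteq> \<sigma>' \<longrightarrow> \<sigma> \<inter> \<sigma>' = {}"
    using cycles_disjoint[OF st] unfolding S_def by blast
  have const: "weight e = \<tau> \<sigma>" if s: "\<sigma> \<in> S" "e \<in> \<sigma>" for e \<sigma>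
  proof -
    have eA: "e \<in> A" using s unfolding S_def by blast
    have "(SOME e. e \<in> \<sigma>) \<in> \<sigma>" using s(2) by (rule someI)
    then obtain k where k: "(SOME e. e \<in> \<sigma>) = (succ_firm \<mu> ^^ k) e"
      using cycle_eq_orbit[OF st, of \<sigma> e] s unfolding S_def by auto
    have "(succ_firm \<mu> ^^ k) e \<in> A \<and> weight ((succ_firm \<mu> ^^ k) e) = weight e" for k
      using eA weight_succ_firm rotating_succ_firm(2)[OF st rot] by (induction k) auto
    then show ?thesis unfolding \<tau>_def k by simp
  qed
  have group: "(\<Sum>e\<in>\<Union>K. h e) = (\<Sum>\<sigma>\<in>K. \<Sum>e\<in>\<sigma>. h e)" if "K \<subseteq> S"
    for K and h :: "'f \<Rightarrow> real ^ 'w ^ 'f"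
    using disj that by (subst sum.Union_disjoint) auto
  have "(\<Sum>e\<in>A. weight e *\<^sub>R transfer \<mu> e) = (\<Sum>\<sigma>\<in>S. \<Sum>e\<in>\<sigma>. weight e *\<^sub>R transfer \<mu> e)"
    using group[OF order_refl] unfolding US .
  also have "\<dots> = (\<Sum>\<sigma>\<in>S. \<tau> \<sigma> *\<^sub>R (\<Sum>e\<in>\<sigma>. transfer \<mu> e))"
    using const by (simp add: scaleR_sum_right)
  finally have x: "x = incidence \<mu> + (\<Sum>\<sigma>\<in>S. \<tau> \<sigma> *\<^sub>R (\<Sum>e\<in>\<sigma>. transfer \<mu> e))"
    using decomposition by simp
  have "x \<in> convex hull {incidence \<mu> + (\<Sum>\<sigma>\<in>K. \<Sum>e\<in>\<sigma>. transfer \<mu> e) | K. K \<subseteq> S}"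
    by (subst x, rule cube_in_convex_hull) (auto simp: \<tau>_def weight_def entry_bounds[OF ssf])
  moreover have "{incidence \<mu> + (\<Sum>\<sigma>\<in>K. \<Sum>e\<in>\<sigma>. transfer \<mu> e) | K. K \<subseteq> S}
      \<subseteq> incidence ` cyclic_family \<mu>"
  proof clarify
    fix K assume K: "K \<subseteq> S"
    then have Kc: "K \<subseteq> cycles \<mu>" unfolding S_def by blast
    have "incidence \<mu> + (\<Sum>\<sigma>\<in>K. \<Sum>e\<in>\<sigma>. transfer \<mu> e) = incidence (shift \<mu> (\<Union>K))"
      unfolding incidence_shift[OF st rotating_Union_cycles[OF st Kc]] group[OF K] ..
    moreover have "shift \<mu> (\<Union>K) \<in> cyclic_family \<mu>"
      using Kc unfolding cyclic_family_eq[OF st] by blast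
    ultimately show "incidence \<mu> + (\<Sum>\<sigma>\<in>K. \<Sum>e\<in>\<sigma>. transfer \<mu> e) \<in> incidence ` cyclic_family \<mu>"
      by blast
  qed
  ultimately show ?thesis
    using hull_mono by blast
qed

end

end

theorem corollary2:
  fixes q :: "'f::finite \<Rightarrow> nat"
    and prefF :: "'f \<Rightarrow> 'w::finite set \<Rightarrow> 'w set \<Rightarrow> bool"
    and prefW :: "'w \<Rightarrow> 'f option \<Rightarrow> 'f option \<Rightarrow> bool"
  assumes "market q prefF prefW"
  shows "market.SSF q prefF prefW =
    (\<Union>\<mu> \<in> market.stable_matchings q prefF prefW.
       convex hull (market.incidence ` market.cyclic_family q prefF prefW \<mu>))"
proof -
  interpret market q prefF prefW by (rule assms)
  show ?thesis
  proof (intro equalityI subsetI)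
    fix x assume "x \<in> SSF"
    then show "x \<in> (\<Union>\<mu>\<in>stable_matchings. convex hull (incidence ` cyclic_family \<mu>))"
      using SSF_in_hull last_matching_stable by blast
  next
    fix x assume "x \<in> (\<Union>\<mu>\<in>stable_matchings. convex hull (incidence ` cyclic_family \<mu>))"
    then show "x \<in> SSF"
      using hull_cyclic_family_subset by blast
  qed
qed

end
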